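(* Let $A=A_n$ be a deterministic real symmetric $n\times n$ matrix, let $E=E_n$ be an $n\times n$ sub-Gaussian matrix, and let $\tilde A=A+E$. Fix $K=K(n)>0$, let $r$ be the number of singular values of $A$ (with multiplicity) smaller than $\sigma_n+3K\sqrt n$, and set $$L:=270\,\log(3+\sigma_1)\cdot\max\left\{\frac{\sqrt n}{K},\ \sqrt{r\log n}\cdot n^{1/4}\right\}.$$ Suppose that $\sigma_n\ge L$. Then, with probability $1-o(1)$ as $n\to\infty$, $$\tilde\sigma_n\ \ge\ \sigma_n-L/2\ \ge\ \sigma_n/2 .$$
   Context: $\sigma_1\ge\dots\ge\sigma_n$ are the singular values of $A$ and $\tilde\sigma_1\ge\dots\ge\tilde\sigma_n$ those of $\tilde A$ (so $\sigma_n$ is the least absolute value of an eigenvalue of $A$). Sub-Gaussian norm: $\|\xi\|_{\psi_2}:=\inf\{c>0:\mathbf E[\exp(\xi^2/c^2)]<2\}$. A symmetric random matrix $E=(\xi_{ij})_{i,j=1}^n$ is a sub-Gaussian matrix if the entries $(\xi_{ij})_{1\le i\le j\le n}$ are independent, centered, and satisfy $C_1\le\mathbf E\xi_{ij}^2\le1$ and $\max_{i,j}\|\xi_{ij}\|_{\psi_2}\le C_2$, for some constants $C_1,C_2>0$ not depending on $n$. Asymptotic notation is as $n\to\infty$ with $C_1,C_2$ fixed. *)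

theory Defs
  imports
    "HOL-Probability.Probability"
    "HOL-Library.Landau_Symbols"
    "Jordan_Normal_Form.Char_Poly"
begin

text \<open>
  The singular values of a square real matrix, in non-increasing order: the square roots of the
  eigenvalues of \<open>A\<^sup>T A\<close>, each repeated according to its multiplicity as a root of the
  characteristic polynomial. As \<open>A\<^sup>T A\<close> is symmetric positive semidefinite, all
  complex roots are real and nonnegative, so for an \<open>n \<times> n\<close> matrix the list has length \<open>n\<close>.
\<close>

definition singular_values :: "real mat \<Rightarrow> real list" where
  "singular_values A =
     rev (sorted_list_of_multiset (image_mset sqrt (proots (char_poly (transpose_mat A * A)))))"

text \<open>\<open>singular_value A k\<close> is \<open>\<sigma>\<^sub>k\<close>, with indices running from \<open>1\<close>.\<close>

definition singular_value :: "real mat \<Rightarrow> nat \<Rightarrow> real" where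
  "singular_value A k = singular_values A ! (k - 1)"

text \<open>
  The norm takes values in \<open>ennreal\<close>, so that it is infinite when no \<open>c\<close> is admissible, and the
  expectation is a nonnegative integral, so that a divergent one is infinite and not \<open>0\<close>.
\<close>

definition psi2_norm :: "'a measure \<Rightarrow> ('a \<Rightarrow> real) \<Rightarrow> ennreal" where
  "psi2_norm M X =
     Inf {ennreal c | c :: real. c > 0 \<and> (\<integral>\<^sup>+\<omega>. ennreal (exp ((X \<omega>)\<^sup>2 / c\<^sup>2)) \<partial>M) < 2}"

definition sub_gaussian_matrix ::
  "real \<Rightarrow> real \<Rightarrow> nat \<Rightarrow> 'a measure \<Rightarrow> ('a \<Rightarrow> real mat) \<Rightarrow> bool" where
  "sub_gaussian_matrix C1 C2 n M E \<longleftrightarrow>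
     (\<forall>\<omega>\<in>space M. E \<omega> \<in> carrier_mat n n \<and> transpose_mat (E \<omega>) = E \<omega>) \<and>
     prob_space.indep_vars M (\<lambda>_. borel) (\<lambda>(i, j) \<omega>. E \<omega> $$ (i, j)) {(i, j). i \<le> j \<and> j < n} \<and>
     (\<forall>i<n. \<forall>j<n.
        has_bochner_integral M (\<lambda>\<omega>. E \<omega> $$ (i, j)) 0 \<and>
        C1 \<le> (\<integral>\<omega>. (E \<omega> $$ (i, j))\<^sup>2 \<partial>M) \<and> (\<integral>\<omega>. (E \<omega> $$ (i, j))\<^sup>2 \<partial>M) \<le> 1 \<and>
        psi2_norm M (\<lambda>\<omega>. E \<omega> $$ (i, j)) \<le> ennreal C2)"

end

theory Submission
  imports Defs "HOL-Real_Asymp.Real_Asymp"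
begin

unbundle no inner_syntax and no vec_syntax

text \<open>
  Write \<open>A = Q D Q\<^sup>T\<close> and suppose that \<open>A + E\<close> had an eigenvalue below \<open>\<sigma>\<^sub>n - L / 2\<close> in
  modulus, with eigenvector \<open>Q y\<close>. Let \<open>S\<close> be the set of the \<open>r\<close> coordinates with
  \<open>\<bar>d\<^sub>i\<bar> < \<sigma>\<^sub>n + T\<close>, where \<open>T = 3 K \<surd>n\<close>. Outside \<open>S\<close> the eigenvalue equation divides by a gap of at
  least \<open>T\<close>, so \<open>y\<close> is concentrated on \<open>S\<close>; on \<open>S\<close> it then shows that \<open>L / 2\<close> is less than the
  norm of the \<open>S \<times> S\<close> block of \<open>Q\<^sup>T E Q\<close> plus \<open>2 \<parallel>E\<parallel>\<^sup>2 / T\<close>. With high probability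
  \<open>\<parallel>E\<parallel> = O(\<surd>n)\<close>, by a union bound over a net of integer vectors, and the block has Frobenius norm at
  most \<open>r\<close> times a slowly growing factor, by a second moment bound. This contradicts the size of \<open>L\<close>,
  unless \<open>L / 2\<close> already exceeds \<open>\<parallel>E\<parallel>\<close>, and then Weyl's inequality suffices.
\<close>

text \<open>The constant 270 is absolute, while any bound on the norm of E carries a constant
  \<open>\<tau>\<close> depending on \<open>C2\<close>. The case distinction therefore compares
  \<open>L / 2\<close> with \<open>\<tau> * sqrt n\<close>. If \<open>L / 2\<close> is the smaller
  one and n is large, then both entries of the maximum in L are small, which forces
  \<open>K > \<tau>\<close> and \<open>r \<le> sqrt n\<close>. The former makes the gap T at least
  twice the norm bound, the condition under which the eigenvector has most of its norm on S. The
  latter makes the crude Frobenius bound affordable: r is then at most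
  \<open>sqrt r * n powr (1 / 4)\<close>, the quantity that occurs in L, and the logarithms in L pay
  for the constants and for a failure probability tending to 0. All estimates are explicit in n and
  \<open>C2\<close>, since a single null sequence has to serve all A, E, K and all probability
  spaces.\<close>

section \<open>Spectral decomposition of real symmetric matrices\<close>

definition diag :: "nat \<Rightarrow> (nat \<Rightarrow> real) \<Rightarrow> real mat" where
  "diag n d = mat n n (\<lambda>(i, j). if i = j then d i else 0)"

lemma diag_carrier [simp]: "diag n d \<in> carrier_mat n n"
  by (simp add: diag_def)

lemma symmetric_mat_entry:
  assumes "A \<in> carrier_mat n n" "transpose_mat A = A" "i < n" "j < n"
  shows "A $$ (i, j) = A $$ (j, i)"
  by (metis assms carrier_matD index_transpose_mat(1))

text \<open>Over the complex numbers the characteristic polynomial has a root \<open>a\<close> with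
  an eigenvector \<open>x\<close>. The Hermitian form of \<open>A\<close> at \<open>x\<close> is
  \<open>a\<close> times the squared norm of \<open>x\<close> and, by symmetry of \<open>A\<close>,
  its own conjugate, so \<open>a\<close> is real. As a real root of the real characteristic
  polynomial it has a real eigenvector.\<close>

lemma symmetric_real_eigenvector:
  fixes A :: "real mat"
  assumes A: "A \<in> carrier_mat n n" and sym: "transpose_mat A = A" and n: "n > 0"
  obtains v k where "v \<in> carrier_vec n" "v \<noteq> 0\<^sub>v n" "A *\<^sub>v v = k \<cdot>\<^sub>v v"
proof -
  interpret of_real_hom: field_hom "of_real :: real \<Rightarrow> complex"
    by unfold_locales auto
  interpret mp: map_poly_inj_idom_hom "of_real :: real \<Rightarrow> complex" ..
  let ?C = "map_mat complex_of_real A"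
  have C: "?C \<in> carrier_mat n n" using A by simp
  obtain as where as: "char_poly ?C = (\<Prod>a\<leftarrow>as. [:- a, 1:])" "length as = n"
    using char_poly_factorized[OF C] by blast
  then obtain a where a: "a \<in> set as" using n by (cases as) auto
  have root: "poly (char_poly ?C) a = 0"
    unfolding as(1) poly_prod_list using a by (force simp: prod_list_zero_iff)
  then have "eigenvalue ?C a" using eigenvalue_root_char_poly[OF C] by simp
  then obtain x where x: "x \<in> carrier_vec n" "x \<noteq> 0\<^sub>v n" "?C *\<^sub>v x = a \<cdot>\<^sub>v x"
    using C unfolding eigenvalue_def eigenvector_def by auto
  have ent: "(\<Sum>j<n. of_real (A $$ (i, j)) * x $ j) = a * x $ i" if "i < n" for i
  proof -
    have "(?C *\<^sub>v x) $ i = (\<Sum>j<n. of_real (A $$ (i, j)) * x $ j)"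
      using that A x(1) by (simp add: scalar_prod_def lessThan_atLeast0)
    then show ?thesis using x that by simp
  qed
  define S where "S = (\<Sum>i<n. (cmod (x $ i))\<^sup>2)"
  obtain i0 where i0: "i0 < n" "x $ i0 \<noteq> 0"
    using x(1,2) by (metis eq_vecI carrier_vecD index_zero_vec)
  have "S > 0"
    unfolding S_def using i0 by (intro sum_pos2[of _ i0]) auto
  define H where "H = (\<Sum>i<n. cnj (x $ i) * (\<Sum>j<n. of_real (A $$ (i, j)) * x $ j))"
  have H1: "H = a * of_real S"
    unfolding H_def S_def of_real_sum sum_distrib_left[of a]
    by (intro sum.cong refl) (subst ent, simp, simp add: complex_norm_square mult_ac del: of_real_power)
  have "cnj H = (\<Sum>i<n. \<Sum>j<n. x $ i * (of_real (A $$ (i, j)) * cnj (x $ j)))"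
    by (simp add: H_def sum_distrib_left)
  also have "\<dots> = (\<Sum>j<n. \<Sum>i<n. x $ i * (of_real (A $$ (i, j)) * cnj (x $ j)))"
    by (rule sum.swap)
  also have "\<dots> = H"
    unfolding H_def sum_distrib_left
    by (intro sum.cong refl) (simp add: mult_ac symmetric_mat_entry[OF A sym])
  finally have "cnj H = H" .
  then have "cnj a = a" using H1 \<open>S > 0\<close> by simp
  then obtain k where k: "a = of_real k"
    by (metis Reals_cases Reals_cnj_iff)
  have "char_poly ?C = map_poly of_real (char_poly A)"
    by (rule of_real_hom.char_poly_hom[OF A])
  then have "poly (char_poly A) k = 0"
    using root k by simp
  then have "eigenvalue A k" using eigenvalue_root_char_poly[OF A] by simp
  then show ?thesis using that A unfolding eigenvalue_def eigenvector_def by auto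
qed

text \<open>The reflection in the hyperplane orthogonal to \<open>v - e\<close>, where
  \<open>e\<close> is the unit vector at index 0, swaps \<open>e\<close> and \<open>v\<close>. The
  formula breaks down only for \<open>v = e\<close>, where the identity serves.\<close>

lemma householder:
  fixes v :: "real vec"
  assumes v: "v \<in> carrier_vec n" and n: "n > 0" and norm: "(\<Sum>i<n. (v $ i)\<^sup>2) = 1"
  obtains W where "W \<in> carrier_mat n n" "transpose_mat W = W" "W * W = 1\<^sub>m n" "col W 0 = v"
proof (cases "v $ 0 = 1")
  case True
  have "(\<Sum>i\<in>{..<n} - {0}. (v $ i)\<^sup>2) = 0"
    using norm n True by (simp add: sum.remove[of _ 0])
  then have "v $ i = 0" if "i < n" "i \<noteq> 0" for i
    using that by (subst (asm) sum_nonneg_eq_0_iff) auto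
  then have "col (1\<^sub>m n) 0 = v"
    using True v n by (intro eq_vecI) (auto simp: unit_vec_def)
  then show ?thesis by (intro that[of "1\<^sub>m n"]) auto
next
  case False
  define c where "c = 1 - v $ 0"
  have c: "c \<noteq> 0" using False by (simp add: c_def)
  define w where "w i = v $ i - (if i = 0 then 1 else 0)" for i :: nat
  \<comment> \<open>For a unit vector \<open>v\<close> the squared length of \<open>v - e\<close> is
    \<open>2 - 2 * v $ 0\<close>, which turns the usual factor of a reflection, 2 divided by the
    squared length, into \<open>1 / c\<close>.\<close>
  have w2: "(\<Sum>i<n. w i * w i) = 2 * c"
  proof -
    have "(\<Sum>i<n. w i * w i) = (\<Sum>i<n. (v $ i)\<^sup>2 + (if i = 0 then 1 - 2 * v $ 0 else 0))"
      by (intro sum.cong) (auto simp: w_def power2_eq_square algebra_simps)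
    also have "\<dots> = 2 * c" using n norm by (simp add: sum.distrib c_def)
    finally show ?thesis .
  qed
  define W where "W = mat n n (\<lambda>(i, j). (if i = j then 1 else 0) - w i * w j / c)"
  have W: "W \<in> carrier_mat n n" by (simp add: W_def)
  have "transpose_mat W = W" by (rule eq_matI) (auto simp: W_def)
  moreover have "W * W = 1\<^sub>m n"
  proof (rule eq_matI)
    fix i j assume "i < dim_row (1\<^sub>m n :: real mat)" "j < dim_col (1\<^sub>m n :: real mat)"
    then have ij: "i < n" "j < n" by auto
    have "(W * W) $$ (i, j) = (\<Sum>k<n. W $$ (i, k) * W $$ (k, j))"
      using ij W by (simp add: scalar_prod_def lessThan_atLeast0)
    also have "\<dots> = (\<Sum>k<n. (if k = i then (if i = j then 1 else 0) - w i * w j / c else 0)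
        - (if k = j then w i * w j / c else 0) + w i * w j / c\<^sup>2 * (w k * w k))"
      using ij by (intro sum.cong) (auto simp: W_def algebra_simps power2_eq_square)
    also have "\<dots> = (if i = j then 1 else 0) - 2 * (w i * w j / c) + w i * w j / c\<^sup>2 * (2 * c)"
      using ij by (simp add: sum.distrib sum_subtractf sum_distrib_left[symmetric] sum_divide_distrib[symmetric] w2)
    also have "\<dots> = (if i = j then 1 else 0)"
      using c by (simp add: power2_eq_square)
    finally show "(W * W) $$ (i, j) = 1\<^sub>m n $$ (i, j)" using ij by simp
  qed (use W in auto)
  moreover have "col W 0 = v"
  proof (rule eq_vecI)
    fix i assume "i < dim_vec v"
    then have "i < n" using v by simp
    moreover have "w 0 = - c" by (simp add: w_def c_def)
    ultimately show "col W 0 $ i = v $ i"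
      using W n c by (simp add: W_def) (simp add: w_def)
  qed (use W v in auto)
  ultimately show ?thesis using W by (intro that[of W])
qed

text \<open>Deflation: conjugation by a reflection that sends a unit eigenvector to the unit vector
  at index 0 makes column 0 of \<open>B\<close> a multiple of that unit vector, symmetry clears row
  0 as well, and the induction hypothesis diagonalises the remaining block.\<close>

theorem symmetric_spectral_decomposition:
  fixes A :: "real mat"
  assumes "A \<in> carrier_mat n n" "transpose_mat A = A"
  shows "\<exists>Q d. Q \<in> carrier_mat n n \<and> transpose_mat Q * Q = 1\<^sub>m n \<and> Q * transpose_mat Q = 1\<^sub>m n \<and>
    A = Q * diag n d * transpose_mat Q"
  using assms
proof (induction n arbitrary: A)
  case 0
  then show ?case
    by (intro exI[of _ "1\<^sub>m 0"] exI[of _ "\<lambda>_. 0"] conjI) (auto intro: eq_matI)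
next
  case (Suc m)
  note A = Suc.prems(1) and sym = Suc.prems(2)
  obtain u k where u: "u \<in> carrier_vec (Suc m)" "u \<noteq> 0\<^sub>v (Suc m)" "A *\<^sub>v u = k \<cdot>\<^sub>v u"
    by (rule symmetric_real_eigenvector[OF A sym]) auto
  define s where "s = (\<Sum>i<Suc m. (u $ i)\<^sup>2)"
  obtain i0 where "i0 < Suc m" "u $ i0 \<noteq> 0"
    using u(1,2) by (metis eq_vecI carrier_vecD index_zero_vec)
  then have s: "s > 0"
    unfolding s_def by (intro sum_pos2[of _ i0]) auto
  define v where "v = (1 / sqrt s) \<cdot>\<^sub>v u"
  have v: "v \<in> carrier_vec (Suc m)" using u by (simp add: v_def)
  have "(\<Sum>i<Suc m. (v $ i)\<^sup>2) = (\<Sum>i<Suc m. (u $ i)\<^sup>2 / s)"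
    using u(1) s by (intro sum.cong) (auto simp: v_def power_divide)
  also have "\<dots> = 1" using s by (simp only: sum_divide_distrib[symmetric] s_def[symmetric]) simp
  finally have "(\<Sum>i<Suc m. (v $ i)\<^sup>2) = 1" .
  from householder[OF v _ this] obtain W where W: "W \<in> carrier_mat (Suc m) (Suc m)"
    "transpose_mat W = W" "W * W = 1\<^sub>m (Suc m)" "col W 0 = v" by auto
  have Av: "A *\<^sub>v v = k \<cdot>\<^sub>v v"
    unfolding v_def using A u by (simp add: mult_mat_vec smult_smult_assoc mult.commute)
  define B where "B = W * A * W"
  have B: "B \<in> carrier_mat (Suc m) (Suc m)" using A W by (simp add: B_def)
  have symB: "transpose_mat B = B"
    unfolding B_def using A W sym
    by (simp add: transpose_mult[of _ "Suc m" "Suc m" _ "Suc m"] assoc_mult_mat[of _ "Suc m" "Suc m" _ "Suc m" _ "Suc m"])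
  have Wv: "W *\<^sub>v v = unit_vec (Suc m) 0"
  proof -
    have "W *\<^sub>v v = col (W * W) 0" unfolding W(4)[symmetric] by (rule col_mult2[symmetric, OF W(1) W(1)]) simp
    then show ?thesis using W(3) by simp
  qed
  have colB: "col B 0 = k \<cdot>\<^sub>v unit_vec (Suc m) 0"
  proof -
    have "col B 0 = (W * A) *\<^sub>v col W 0"
      unfolding B_def by (rule col_mult2[of _ "Suc m" "Suc m" _ "Suc m"]) (use A W in auto)
    also have "\<dots> = W *\<^sub>v (A *\<^sub>v v)"
      unfolding W(4) using A W v by simp
    also have "\<dots> = k \<cdot>\<^sub>v unit_vec (Suc m) 0"
      unfolding Av using W v by (simp add: mult_mat_vec Wv)
    finally show ?thesis .
  qed
  have B0: "B $$ (i, 0) = (if i = 0 then k else 0)" if "i < Suc m" for i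
    using arg_cong[OF colB, of "\<lambda>x. x $ i"] B that by (simp add: unit_vec_def)
  have B0': "B $$ (0, i) = (if i = 0 then k else 0)" if "i < Suc m" for i
    using B0[OF that] symmetric_mat_entry[OF B symB _ that, of 0] by simp
  define B' where "B' = mat m m (\<lambda>(i, j). B $$ (Suc i, Suc j))"
  have B': "B' \<in> carrier_mat m m" by (simp add: B'_def)
  have "transpose_mat B' = B'"
    by (rule eq_matI) (auto simp: B'_def symmetric_mat_entry[OF B symB])
  from Suc.IH[OF B' this] obtain P d where P: "P \<in> carrier_mat m m"
    "transpose_mat P * P = 1\<^sub>m m" "P * transpose_mat P = 1\<^sub>m m" "B' = P * diag m d * transpose_mat P"
    by blast
  let ?blk = "\<lambda>X Y. four_block_mat X (0\<^sub>m 1 m) (0\<^sub>m m 1) Y"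
  define K :: "real mat" where "K = mat 1 1 (\<lambda>_. k)"
  have K: "K \<in> carrier_mat 1 1" by (simp add: K_def)
  have blk_mult: "?blk X Y * ?blk X' Y' = ?blk (X * X') (Y * Y')"
    if "X \<in> carrier_mat 1 1" "X' \<in> carrier_mat 1 1" "Y \<in> carrier_mat m m" "Y' \<in> carrier_mat m m"
    for X X' Y Y' :: "real mat"
    by (subst mult_four_block_mat[of _ 1 1 _ m _ m _ _ 1 _ m]) (use that in auto)
  define R where "R = ?blk (1\<^sub>m 1) P"
  have R: "R \<in> carrier_mat (Suc m) (Suc m)"
    using P four_block_carrier_mat[of "1\<^sub>m 1 :: real mat" 1 1 P m m] by (simp add: R_def)
  have RT: "transpose_mat R = ?blk (1\<^sub>m 1) (transpose_mat P)"
    unfolding R_def by (subst transpose_four_block_mat[of _ 1 1 _ m _ m]) (use P in auto)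
  have one: "?blk (1\<^sub>m 1) (1\<^sub>m m) = (1\<^sub>m (Suc m) :: real mat)"
    using four_block_one_mat[of 1 m, where 'a = real] by simp
  have RTR: "transpose_mat R * R = 1\<^sub>m (Suc m)" "R * transpose_mat R = 1\<^sub>m (Suc m)"
    unfolding RT unfolding R_def using P by (simp_all add: blk_mult one plus_1_eq_Suc del: One_nat_def)
  define e where "e i = (case i of 0 \<Rightarrow> k | Suc j \<Rightarrow> d j)" for i
  have D: "diag (Suc m) e = ?blk K (diag m d)"
    by (rule eq_matI) (auto simp: diag_def K_def e_def split: nat.splits)
  have BR: "B = R * diag (Suc m) e * transpose_mat R"
  proof -
    have "B = ?blk K B'"
      using B by (intro eq_matI) (auto simp: K_def B'_def B0 B0')
    then show ?thesis
      unfolding D RT unfolding R_def using P K by (simp add: blk_mult del: One_nat_def)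
  qed
  note assoc = assoc_mult_mat[of _ "Suc m" "Suc m" _ "Suc m" _ "Suc m"]
  define Q where "Q = W * R"
  have Q: "Q \<in> carrier_mat (Suc m) (Suc m)" using W R by (simp add: Q_def)
  have QT: "transpose_mat Q = transpose_mat R * W"
    unfolding Q_def using W R by (simp add: transpose_mult[of _ "Suc m" "Suc m" _ "Suc m"])
  have WWX: "W * (W * X) = X" if "X \<in> carrier_mat (Suc m) (Suc m)" for X
    using that W by (simp add: assoc[symmetric])
  have RRX: "R * (transpose_mat R * X) = X" if "X \<in> carrier_mat (Suc m) (Suc m)" for X
    using that R RTR by (simp add: assoc[symmetric])
  have "transpose_mat Q * Q = 1\<^sub>m (Suc m)"
    unfolding QT unfolding Q_def using W R RTR by (simp add: assoc WWX)
  moreover have "Q * transpose_mat Q = 1\<^sub>m (Suc m)"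
    unfolding QT unfolding Q_def using W R by (simp add: assoc RRX)
  moreover have "A = Q * diag (Suc m) e * transpose_mat Q"
  proof -
    have "A = W * B * W"
      unfolding B_def using W A by (simp add: assoc WWX)
    also have "\<dots> = Q * diag (Suc m) e * transpose_mat Q"
      unfolding BR QT unfolding Q_def using W R diag_carrier[of "Suc m" e] by (simp add: assoc del: diag_carrier)
    finally show ?thesis .
  qed
  ultimately show ?case using Q by blast
qed

section \<open>Singular values of a symmetric matrix as moduli of its eigenvalues\<close>

text \<open>The Gram matrix of \<open>A\<close> is similar to the diagonal matrix of the squares of
  \<open>d\<close>, so its characteristic polynomial splits into explicit linear factors with the
  right multiplicities.\<close>

lemma mset_singular_values:
  assumes Q: "Q \<in> carrier_mat n n" "transpose_mat Q * Q = 1\<^sub>m n" "Q * transpose_mat Q = 1\<^sub>m n"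
    and A: "A = Q * diag n d * transpose_mat Q"
  shows "mset (singular_values A) = image_mset (\<lambda>i. \<bar>d i\<bar>) (mset_set {..<n})"
proof -
  note assoc = assoc_mult_mat[of _ n n _ n _ n]
  have QQX: "transpose_mat Q * (Q * X) = X" if "X \<in> carrier_mat n n" for X
    using that Q by (simp add: assoc[symmetric])
  have diagT: "transpose_mat (diag n d) = diag n d"
    by (rule eq_matI) (auto simp: diag_def)
  have diag2: "diag n d * diag n d = diag n (\<lambda>i. (d i)\<^sup>2)"
  proof (rule eq_matI)
    fix i j assume "i < dim_row (diag n (\<lambda>i. (d i)\<^sup>2))" "j < dim_col (diag n (\<lambda>i. (d i)\<^sup>2))"
    then have ij: "i < n" "j < n" by (auto simp: diag_def)
    have "(diag n d * diag n d) $$ (i, j) = (\<Sum>k<n. (if k = i then if k = j then (d i)\<^sup>2 else 0 else 0))"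
    proof -
      have "(diag n d * diag n d) $$ (i, j) = (\<Sum>k<n. diag n d $$ (i, k) * diag n d $$ (k, j))"
        using ij by (simp add: scalar_prod_def lessThan_atLeast0 diag_def)
      also have "\<dots> = (\<Sum>k<n. (if k = i then if k = j then (d i)\<^sup>2 else 0 else 0))"
        using ij by (intro sum.cong) (auto simp: diag_def power2_eq_square)
      finally show ?thesis .
    qed
    then show "(diag n d * diag n d) $$ (i, j) = diag n (\<lambda>i. (d i)\<^sup>2) $$ (i, j)"
      using ij by (simp add: diag_def)
  qed (auto simp: diag_def)
  have "transpose_mat A = Q * diag n d * transpose_mat Q"
    unfolding A using Q(1) diag_carrier[of n d]
    by (simp add: transpose_mult[of _ n n _ n] diagT assoc del: diag_carrier)
  then have "transpose_mat A * A = Q * (diag n d * diag n d) * transpose_mat Q"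
    unfolding A using Q(1) diag_carrier[of n d] by (simp add: assoc QQX del: diag_carrier)
  then have "similar_mat (transpose_mat A * A) (diag n (\<lambda>i. (d i)\<^sup>2))"
    unfolding diag2 using Q by (intro similar_matI[of _ _ Q "transpose_mat Q" n]) auto
  then have "char_poly (transpose_mat A * A) = char_poly (diag n (\<lambda>i. (d i)\<^sup>2))"
    by (rule char_poly_similar)
  also have "\<dots> = (\<Prod>a\<leftarrow>diag_mat (diag n (\<lambda>i. (d i)\<^sup>2)). [:- a, 1:])"
    by (rule char_poly_upper_triangular[of _ n]) (auto simp: diag_def)
  also have "diag_mat (diag n (\<lambda>i. (d i)\<^sup>2)) = map (\<lambda>i. (d i)\<^sup>2) [0..<n]"
    by (auto simp: diag_mat_def diag_def)
  finally have cp: "char_poly (transpose_mat A * A) = (\<Prod>a\<leftarrow>map (\<lambda>i. (d i)\<^sup>2) [0..<n]. [:- a, 1:])" .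
  have pr: "proots (\<Prod>a\<leftarrow>xs. [:- a, 1:]) = mset xs" for xs :: "real list"
  proof (induction xs)
    case (Cons x xs)
    have "(\<Prod>a\<leftarrow>xs. [:- a, 1:]) \<noteq> 0" by (auto simp: prod_list_zero_iff)
    then show ?case
      using Cons by (simp add: proots_mult del: mult_pCons_left)
  qed simp
  show ?thesis
    unfolding singular_values_def cp pr
    by (simp add: multiset.map_comp comp_def flip: mset_upt atLeast0LessThan)
qed

lemma length_singular_values:
  assumes "A \<in> carrier_mat n n" "transpose_mat A = A"
  shows "length (singular_values A) = n"
proof -
  obtain Q d where "Q \<in> carrier_mat n n" "transpose_mat Q * Q = 1\<^sub>m n" "Q * transpose_mat Q = 1\<^sub>m n"
    "A = Q * diag n d * transpose_mat Q"
    using symmetric_spectral_decomposition[OF assms] by blast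
  from mset_singular_values[OF this] have "size (mset (singular_values A)) = n" by simp
  then show ?thesis by simp
qed

lemma singular_value_antimono:
  assumes "A \<in> carrier_mat n n" "transpose_mat A = A" "1 \<le> k" "k \<le> l" "l \<le> n"
  shows "singular_value A l \<le> singular_value A k"
proof -
  have "sorted (rev (singular_values A))" by (simp add: singular_values_def)
  then have "sorted_wrt (\<ge>) (singular_values A)" by (simp add: sorted_wrt_rev)
  then show ?thesis
    using assms length_singular_values[OF assms(1,2)]
    unfolding singular_value_def
    by (cases "k = l") (auto simp: sorted_wrt_iff_nth_less)
qed

lemma least_singular_value:
  assumes Q: "Q \<in> carrier_mat n n" "transpose_mat Q * Q = 1\<^sub>m n" "Q * transpose_mat Q = 1\<^sub>m n"
    and A: "A = Q * diag n d * transpose_mat Q" "transpose_mat A = A" and n: "n \<ge> 1"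
  shows "i < n \<Longrightarrow> singular_value A n \<le> \<bar>d i\<bar>"
    and "\<exists>i<n. singular_value A n = \<bar>d i\<bar>"
proof -
  have carr: "A \<in> carrier_mat n n" unfolding A(1) using Q(1) by (intro mult_carrier_mat[of _ n n]) auto
  note len = length_singular_values[OF carr A(2)]
  have "set (singular_values A) = set_mset (mset (singular_values A))" by simp
  also have "\<dots> = (\<lambda>i. \<bar>d i\<bar>) ` {..<n}"
    by (subst mset_singular_values[OF Q A(1)]) simp
  finally have set: "set (singular_values A) = (\<lambda>i. \<bar>d i\<bar>) ` {..<n}" .
  show "singular_value A n \<le> \<bar>d i\<bar>" if "i < n"
  proof -
    have "\<bar>d i\<bar> \<in> set (singular_values A)" using set that by auto
    then obtain k where "k < n" "\<bar>d i\<bar> = singular_values A ! k"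
      using len by (metis in_set_conv_nth)
    then show ?thesis
      using singular_value_antimono[OF carr A(2), of "Suc k" n] by (simp add: singular_value_def)
  qed
  have "singular_value A n \<in> set (singular_values A)"
    using len n by (simp add: singular_value_def)
  then show "\<exists>i<n. singular_value A n = \<bar>d i\<bar>" using set by auto
qed

text \<open>Turns \<open>r\<close>, a count of positions in a sorted list, into the cardinality of a
  set of eigenvector coordinates. Both are the size of one filtered multiset.\<close>

lemma card_small_singular_values:
  assumes Q: "Q \<in> carrier_mat n n" "transpose_mat Q * Q = 1\<^sub>m n" "Q * transpose_mat Q = 1\<^sub>m n"
    and A: "A = Q * diag n d * transpose_mat Q" "transpose_mat A = A"
  shows "card {k \<in> {1..n}. singular_value A k < t} = card {i. i < n \<and> \<bar>d i\<bar> < t}"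
proof -
  have carr: "A \<in> carrier_mat n n" unfolding A(1) using Q(1) by (intro mult_carrier_mat[of _ n n]) auto
  note len = length_singular_values[OF carr A(2)]
  have "card {k \<in> {1..n}. singular_value A k < t} = card {k. k < n \<and> singular_values A ! k < t}"
    by (rule bij_betw_same_card[of "\<lambda>k. k - 1"], rule bij_betwI[where g = Suc])
       (auto simp: singular_value_def)
  also have "\<dots> = length (filter (\<lambda>x. x < t) (singular_values A))"
    by (simp add: length_filter_conv_card len)
  also have "\<dots> = size (filter_mset (\<lambda>x. x < t) (mset (singular_values A)))"
    by (metis mset_filter size_mset)
  also have "\<dots> = card {i. i < n \<and> \<bar>d i\<bar> < t}"
    by (simp add: mset_singular_values[OF Q A(1)] filter_mset_image_mset)
  finally show ?thesis .
qed

section \<open>Matrices as operators on coordinates, and variational bounds\<close>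

text \<open>Vectors are plain functions, so that \<open>L2_set\<close> and finite sums apply to them
  and to their restrictions to sets of coordinates. Their values at indices \<open>n\<close> and
  above never enter.\<close>

definition mat_app :: "nat \<Rightarrow> real mat \<Rightarrow> (nat \<Rightarrow> real) \<Rightarrow> nat \<Rightarrow> real" where
  "mat_app n A x i = (\<Sum>j<n. A $$ (i, j) * x j)"

lemma mat_app_mult:
  assumes "A \<in> carrier_mat n n" "B \<in> carrier_mat n n" "i < n"
  shows "mat_app n (A * B) x i = mat_app n A (mat_app n B x) i"
proof -
  have "mat_app n (A * B) x i = (\<Sum>j<n. \<Sum>k<n. A $$ (i, k) * B $$ (k, j) * x j)"
    using assms by (simp add: mat_app_def scalar_prod_def lessThan_atLeast0 sum_distrib_right)
  also have "\<dots> = (\<Sum>k<n. \<Sum>j<n. A $$ (i, k) * B $$ (k, j) * x j)" by (rule sum.swap)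
  finally show ?thesis by (simp add: mat_app_def sum_distrib_left mult.assoc)
qed

lemma mat_app_cong:
  assumes "\<And>j. j < n \<Longrightarrow> x j = y j"
  shows "mat_app n A x i = mat_app n A y i"
  using assms by (simp add: mat_app_def)

lemma mat_app_add:
  assumes "A \<in> carrier_mat n n" "B \<in> carrier_mat n n" "i < n"
  shows "mat_app n (A + B) x i = mat_app n A x i + mat_app n B x i"
  using assms by (simp add: mat_app_def distrib_right sum.distrib)

lemma mat_app_one:
  assumes "i < n"
  shows "mat_app n (1\<^sub>m n) x i = x i"
proof -
  have "mat_app n (1\<^sub>m n) x i = (\<Sum>j<n. if j = i then x i else 0)"
    unfolding mat_app_def using assms by (intro sum.cong) auto
  then show ?thesis using assms by simp
qed

lemma mat_app_diag:
  assumes "i < n"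
  shows "mat_app n (diag n d) x i = d i * x i"
proof -
  have "mat_app n (diag n d) x i = (\<Sum>j<n. if j = i then d i * x i else 0)"
    unfolding mat_app_def using assms by (intro sum.cong) (auto simp: diag_def)
  then show ?thesis using assms by simp
qed

lemma mat_app_adjoint:
  assumes "A \<in> carrier_mat n n"
  shows "(\<Sum>i<n. y i * mat_app n A x i) = (\<Sum>j<n. mat_app n (transpose_mat A) y j * x j)"
proof -
  have "(\<Sum>i<n. y i * mat_app n A x i) = (\<Sum>i<n. \<Sum>j<n. y i * A $$ (i, j) * x j)"
    by (simp add: mat_app_def sum_distrib_left mult.assoc)
  also have "\<dots> = (\<Sum>j<n. \<Sum>i<n. y i * A $$ (i, j) * x j)" by (rule sum.swap)
  also have "\<dots> = (\<Sum>j<n. mat_app n (transpose_mat A) y j * x j)"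
    unfolding mat_app_def sum_distrib_right
    using assms by (intro sum.cong refl) (auto simp: mult_ac)
  finally show ?thesis .
qed

lemma L2_set_orthogonal:
  assumes "Q \<in> carrier_mat n n" "transpose_mat Q * Q = 1\<^sub>m n"
  shows "L2_set (mat_app n Q x) {..<n} = L2_set x {..<n}"
proof -
  have "(\<Sum>i<n. (mat_app n Q x i)\<^sup>2) = (\<Sum>j<n. mat_app n (transpose_mat Q) (mat_app n Q x) j * x j)"
    using mat_app_adjoint[OF assms(1), of "mat_app n Q x" x] by (simp add: power2_eq_square)
  also have "\<dots> = (\<Sum>j<n. (x j)\<^sup>2)"
    using assms by (intro sum.cong refl)
      (simp add: power2_eq_square mat_app_one flip: mat_app_mult)
  finally show ?thesis by (simp add: L2_set_def)
qed

lemma L2_set_scale: "L2_set (\<lambda>i. c * x i) I = \<bar>c\<bar> * L2_set x I"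
  by (simp add: L2_set_def power_mult_distrib real_sqrt_mult flip: sum_distrib_left)

lemma L2_set_cong: "(\<And>i. i \<in> I \<Longrightarrow> x i = y i) \<Longrightarrow> L2_set x I = L2_set y I"
  by (simp add: L2_set_def)

lemma L2_set_mono_abs:
  assumes "\<And>i. i \<in> I \<Longrightarrow> \<bar>x i\<bar> \<le> \<bar>y i\<bar>"
  shows "L2_set x I \<le> L2_set y I"
  unfolding L2_set_def
  by (intro real_sqrt_le_mono sum_mono) (use assms in \<open>auto simp: abs_le_square_iff\<close>)

lemma L2_set_subset_le:
  assumes "finite J" "I \<subseteq> J"
  shows "L2_set x I \<le> L2_set x J"
  unfolding L2_set_def by (intro real_sqrt_le_mono sum_mono2) (use assms in auto)

lemma symmetric_mat_app:
  assumes Q: "Q \<in> carrier_mat n n" "transpose_mat Q * Q = 1\<^sub>m n" "Q * transpose_mat Q = 1\<^sub>m n"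
    and A: "A = Q * diag n d * transpose_mat Q"
  shows "L2_set (mat_app n A x) {..<n} = L2_set (\<lambda>i. d i * mat_app n (transpose_mat Q) x i) {..<n}"
    and "L2_set (mat_app n (transpose_mat Q) x) {..<n} = L2_set x {..<n}"
    and "\<And>i j. i < n \<Longrightarrow> j < n \<Longrightarrow> mat_app n A (\<lambda>k. Q $$ (k, j)) i = d j * Q $$ (i, j)"
    and "\<And>j. j < n \<Longrightarrow> L2_set (\<lambda>k. Q $$ (k, j)) {..<n} = 1"
proof -
  have "L2_set (mat_app n A x) {..<n} = L2_set (mat_app n Q (mat_app n (diag n d) (mat_app n (transpose_mat Q) x))) {..<n}"
    unfolding A using Q by (intro L2_set_cong) (auto simp: mat_app_mult cong: mat_app_cong)
  also have "\<dots> = L2_set (mat_app n (diag n d) (mat_app n (transpose_mat Q) x)) {..<n}"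
    by (rule L2_set_orthogonal[OF Q(1,2)])
  also have "\<dots> = L2_set (\<lambda>i. d i * mat_app n (transpose_mat Q) x i) {..<n}"
    by (rule L2_set_cong) (simp add: mat_app_diag)
  finally show "L2_set (mat_app n A x) {..<n} = L2_set (\<lambda>i. d i * mat_app n (transpose_mat Q) x i) {..<n}" .
  show "L2_set (mat_app n (transpose_mat Q) x) {..<n} = L2_set x {..<n}"
    by (rule L2_set_orthogonal) (use Q in auto)
  fix j assume j: "j < n"
  define e where "e i = (if i = j then 1 else 0 :: real)" for i :: nat
  have e: "mat_app n B e i = B $$ (i, j)" for B i
    unfolding mat_app_def e_def using j by (simp add: if_distrib cong: if_cong)
  have QTQ: "mat_app n (transpose_mat Q) (\<lambda>k. Q $$ (k, j)) i = e i" if "i < n" for i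
  proof -
    have "mat_app n (transpose_mat Q * Q) e i = e i" using Q that by (simp add: mat_app_one)
    moreover have "mat_app n Q e = (\<lambda>k. Q $$ (k, j))" using e by auto
    ultimately show ?thesis using mat_app_mult[of "transpose_mat Q" n Q i e] Q that by simp
  qed
  show "mat_app n A (\<lambda>k. Q $$ (k, j)) i = d j * Q $$ (i, j)" if "i < n" for i
  proof -
    have "mat_app n A (\<lambda>k. Q $$ (k, j)) i = mat_app n Q (mat_app n (diag n d) (mat_app n (transpose_mat Q) (\<lambda>k. Q $$ (k, j)))) i"
      unfolding A using Q that by (auto simp: mat_app_mult cong: mat_app_cong)
    also have "\<dots> = mat_app n Q (\<lambda>i. d j * e i) i"
      by (intro mat_app_cong) (simp add: mat_app_diag QTQ, simp add: e_def)
    also have "\<dots> = d j * mat_app n Q e i"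
      by (simp add: mat_app_def sum_distrib_left mult_ac)
    finally show ?thesis by (simp add: e)
  qed
  have "L2_set (mat_app n Q e) {..<n} = L2_set e {..<n}"
    by (rule L2_set_orthogonal[OF Q(1,2)])
  moreover have "L2_set e {..<n} = 1"
  proof -
    have "(\<Sum>i<n. (e i)\<^sup>2) = (\<Sum>i<n. if i = j then 1 else 0)"
      by (intro sum.cong) (auto simp: e_def)
    then show ?thesis using j by (simp add: L2_set_def)
  qed
  ultimately show "L2_set (\<lambda>k. Q $$ (k, j)) {..<n} = 1" by (simp add: e[abs_def])
qed

lemma least_singular_value_eigenvector:
  assumes "A \<in> carrier_mat n n" "transpose_mat A = A" "n \<ge> 1"
  obtains x k where "L2_set x {..<n} = 1" "\<And>i. i < n \<Longrightarrow> mat_app n A x i = k * x i"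
    "\<bar>k\<bar> = singular_value A n"
proof -
  obtain Q d where Q: "Q \<in> carrier_mat n n" "transpose_mat Q * Q = 1\<^sub>m n" "Q * transpose_mat Q = 1\<^sub>m n"
    and A: "A = Q * diag n d * transpose_mat Q"
    using symmetric_spectral_decomposition[OF assms(1,2)] by blast
  from least_singular_value(2)[OF Q A assms(2,3)]
  obtain j where "j < n" "singular_value A n = \<bar>d j\<bar>" by blast
  then show ?thesis
    using symmetric_mat_app(3,4)[OF Q A]
    by (intro that[of "\<lambda>k. Q $$ (k, j)" "d j"]) auto
qed

text \<open>Expresses the least singular value by norm inequalities that are homogeneous and
  continuous in \<open>x\<close>. In this form Weyl's inequality is the triangle inequality, and
  measurability reduces to countably many \<open>x\<close>.\<close>

lemma le_least_singular_value_iff: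
  assumes sA: "A \<in> carrier_mat n n" "transpose_mat A = A" and n: "n \<ge> 1"
  shows "s \<le> singular_value A n \<longleftrightarrow> (\<forall>x. s * L2_set x {..<n} \<le> L2_set (mat_app n A x) {..<n})"
proof
  assume s: "s \<le> singular_value A n"
  obtain Q d where Q: "Q \<in> carrier_mat n n" "transpose_mat Q * Q = 1\<^sub>m n" "Q * transpose_mat Q = 1\<^sub>m n"
    and A: "A = Q * diag n d * transpose_mat Q"
    using symmetric_spectral_decomposition[OF sA] by blast
  note lsv = least_singular_value[OF Q A sA(2) n]
  have pos: "singular_value A n \<ge> 0" using lsv(2) by auto
  show "\<forall>x. s * L2_set x {..<n} \<le> L2_set (mat_app n A x) {..<n}"
  proof
    fix x
    let ?y = "mat_app n (transpose_mat Q) x"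
    have "s * L2_set x {..<n} \<le> singular_value A n * L2_set ?y {..<n}"
      unfolding symmetric_mat_app(2)[OF Q A] by (intro mult_right_mono s L2_set_nonneg)
    also have "\<dots> = L2_set (\<lambda>i. singular_value A n * ?y i) {..<n}"
      using pos by (simp add: L2_set_scale)
    also have "\<dots> \<le> L2_set (\<lambda>i. d i * ?y i) {..<n}"
      using pos lsv(1) by (intro L2_set_mono_abs) (auto simp: abs_mult intro!: mult_right_mono)
    also have "\<dots> = L2_set (mat_app n A x) {..<n}"
      by (rule symmetric_mat_app(1)[OF Q A, symmetric])
    finally show "s * L2_set x {..<n} \<le> L2_set (mat_app n A x) {..<n}" .
  qed
next
  assume s: "\<forall>x. s * L2_set x {..<n} \<le> L2_set (mat_app n A x) {..<n}"
  obtain x k where x: "L2_set x {..<n} = 1" "\<And>i. i < n \<Longrightarrow> mat_app n A x i = k * x i"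
    "\<bar>k\<bar> = singular_value A n"
    using least_singular_value_eigenvector[OF assms] by blast
  have "s * L2_set x {..<n} \<le> L2_set (mat_app n A x) {..<n}" using s by blast
  also have "\<dots> = L2_set (\<lambda>i. k * x i) {..<n}" by (rule L2_set_cong) (simp add: x(2))
  finally show "s \<le> singular_value A n" by (simp add: L2_set_scale x)
qed

text \<open>The norm is attained at an eigenvector, which gives the net argument an exact expansion
  of the quadratic form around \<open>x\<close>.\<close>

lemma symmetric_top_eigenvector:
  assumes sA: "A \<in> carrier_mat n n" "transpose_mat A = A" and n: "n \<ge> 1"
  obtains x k where "L2_set x {..<n} = 1" "\<And>i. i < n \<Longrightarrow> mat_app n A x i = k * x i"
    "\<And>z. L2_set (mat_app n A z) {..<n} \<le> \<bar>k\<bar> * L2_set z {..<n}"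
proof -
  obtain Q d where Q: "Q \<in> carrier_mat n n" "transpose_mat Q * Q = 1\<^sub>m n" "Q * transpose_mat Q = 1\<^sub>m n"
    and A: "A = Q * diag n d * transpose_mat Q"
    using symmetric_spectral_decomposition[OF sA] by blast
  have "Max ((\<lambda>i. \<bar>d i\<bar>) ` {..<n}) \<in> (\<lambda>i. \<bar>d i\<bar>) ` {..<n}"
    using n by (intro Max_in) (auto simp: lessThan_empty_iff)
  then obtain j where j: "j < n" "Max ((\<lambda>i. \<bar>d i\<bar>) ` {..<n}) = \<bar>d j\<bar>" by auto
  have dj: "\<bar>d i\<bar> \<le> \<bar>d j\<bar>" if "i < n" for i
    unfolding j(2)[symmetric] using that by (intro Max_ge) auto
  have "L2_set (mat_app n A z) {..<n} \<le> \<bar>d j\<bar> * L2_set z {..<n}" for z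
  proof -
    let ?y = "mat_app n (transpose_mat Q) z"
    have "L2_set (mat_app n A z) {..<n} = L2_set (\<lambda>i. d i * ?y i) {..<n}"
      by (rule symmetric_mat_app(1)[OF Q A])
    also have "\<dots> \<le> L2_set (\<lambda>i. d j * ?y i) {..<n}"
      using dj by (intro L2_set_mono_abs) (auto simp: abs_mult intro!: mult_right_mono)
    also have "\<dots> = \<bar>d j\<bar> * L2_set z {..<n}"
      by (simp add: L2_set_scale symmetric_mat_app(2)[OF Q A])
    finally show ?thesis .
  qed
  with symmetric_mat_app(3,4)[OF Q A] j(1) show ?thesis
    by (intro that[of "\<lambda>k. Q $$ (k, j)" "d j"]) auto
qed

section \<open>Deterministic perturbation of the least singular value\<close>

lemma L2_set_bilinear_le:
  "\<bar>\<Sum>i\<in>I. x i * y i\<bar> \<le> L2_set x I * L2_set y I"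
proof -
  have "\<bar>\<Sum>i\<in>I. x i * y i\<bar> \<le> (\<Sum>i\<in>I. \<bar>x i\<bar> * \<bar>y i\<bar>)"
    by (rule order.trans[OF sum_abs]) (simp add: abs_mult)
  also have "\<dots> \<le> L2_set x I * L2_set y I" by (rule L2_set_mult_ineq)
  finally show ?thesis .
qed

lemma L2_set_frobenius:
  assumes "(\<Sum>i\<in>I. \<Sum>j\<in>J. (F i j)\<^sup>2) \<le> c\<^sup>2" "c \<ge> 0"
  shows "L2_set (\<lambda>i. \<Sum>j\<in>J. F i j * y j) I \<le> c * L2_set y J"
proof -
  have "(\<Sum>i\<in>I. (\<Sum>j\<in>J. F i j * y j)\<^sup>2) \<le> (\<Sum>i\<in>I. (\<Sum>j\<in>J. (F i j)\<^sup>2) * (\<Sum>j\<in>J. (y j)\<^sup>2))"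
    by (intro sum_mono Cauchy_Schwarz_ineq_sum)
  also have "\<dots> \<le> c\<^sup>2 * (\<Sum>j\<in>J. (y j)\<^sup>2)"
    unfolding sum_distrib_right[symmetric] by (intro mult_right_mono assms sum_nonneg) auto
  finally have "L2_set (\<lambda>i. \<Sum>j\<in>J. F i j * y j) I \<le> sqrt (c\<^sup>2 * (\<Sum>j\<in>J. (y j)\<^sup>2))"
    unfolding L2_set_def by (rule real_sqrt_le_mono)
  also have "\<dots> = c * L2_set y J"
    using assms(2) by (simp add: L2_set_def real_sqrt_mult)
  finally show ?thesis .
qed

text \<open>
  An eigenvector of \<open>D + F\<close> whose eigenvalue is well below \<open>\<sigma>\<close> in modulus is concentrated on the
  coordinates with small \<open>\<bar>d i\<bar>\<close>, since its other coordinates are divided by a gap of at least \<open>T\<close>.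
  On those coordinates it only feels the small block of \<open>F\<close> and a second order term \<open>N\<^sup>2 / T\<close>.
\<close>

lemma perturbed_diagonal_no_small_eigenvalue:
  fixes d y :: "nat \<Rightarrow> real" and F :: "nat \<Rightarrow> nat \<Rightarrow> real"
  assumes S_def: "S = {i. i < n \<and> \<bar>d i\<bar> < \<sigma> + T}"
    and N: "\<And>z. L2_set (\<lambda>i. \<Sum>j<n. F i j * z j) {..<n} \<le> N * L2_set z {..<n}"
    and T: "0 < T" "2 * N \<le> T"
    and \<Phi>: "0 \<le> \<Phi>" "(\<Sum>i\<in>S. \<Sum>j\<in>S. (F i j)\<^sup>2) \<le> \<Phi>\<^sup>2" "\<Phi> + 2 * N\<^sup>2 / T \<le> l"
    and d: "\<And>i. i < n \<Longrightarrow> \<sigma> \<le> \<bar>d i\<bar>"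
    and ev: "\<And>i. i < n \<Longrightarrow> d i * y i + (\<Sum>j<n. F i j * y j) = k * y i"
    and k: "\<bar>k\<bar> < \<sigma> - l"
  shows "L2_set y {..<n} = 0"
proof (rule ccontr)
  define R where "R = {..<n} - S"
  define w where "w = L2_set y {..<n}"
  define u where "u = L2_set y S"
  define v where "v = L2_set y R"
  define G where "G i = (\<Sum>j<n. F i j * y j)" for i
  assume "L2_set y {..<n} \<noteq> 0"
  then have w: "w > 0" using L2_set_nonneg[of y "{..<n}"] unfolding w_def by linarith
  have fin: "finite S" "finite R" "S \<inter> R = {}" "S \<union> R = {..<n}" "S \<subseteq> {..<n}" "R \<subseteq> {..<n}"
    by (auto simp: S_def R_def)
  have uv: "u \<ge> 0" "v \<ge> 0" by (auto simp: u_def v_def L2_set_nonneg)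
  have l: "l \<ge> 0"
    using \<Phi>(1,3) T(1) by (smt (verit) divide_nonneg_pos zero_le_power2)
  have "0 \<le> N * w"
    using N[of y] L2_set_nonneg unfolding w_def by (rule order.trans[rotated])
  then have N0: "N \<ge> 0" using w by (simp add: zero_le_mult_iff)
  have L2_sq: "(L2_set y I)\<^sup>2 = (\<Sum>i\<in>I. (y i)\<^sup>2)" for I :: "nat set"
    by (simp add: L2_set_def sum_nonneg)
  have "w\<^sup>2 = u\<^sup>2 + v\<^sup>2"
    using sum.union_disjoint[OF fin(1,2,3), of "\<lambda>i. (y i)\<^sup>2"]
    unfolding fin(4) w_def u_def v_def L2_sq .
  also have "\<dots> \<le> (u + v)\<^sup>2" using uv by (simp add: power2_sum)
  finally have wuv: "w \<le> u + v" by (rule power2_le_imp_le) (use uv in simp)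
  have Gk: "G i = (k - d i) * y i" if "i < n" for i
    using ev[OF that] by (simp add: G_def algebra_simps)
  \<comment> \<open>On \<open>R\<close> the factor \<open>k - d i\<close> has modulus at least
    \<open>T\<close>, because \<open>\<bar>d i\<bar>\<close> is at least \<open>\<sigma> + T\<close>
    and \<open>\<bar>k\<bar>\<close> is below \<open>\<sigma>\<close>.\<close>
  have "T * v = L2_set (\<lambda>i. T * y i) R" using T by (simp add: L2_set_scale v_def)
  also have "\<dots> \<le> L2_set G R"
  proof (rule L2_set_mono_abs)
    fix i assume "i \<in> R"
    then have "i < n" "\<sigma> + T \<le> \<bar>d i\<bar>" by (auto simp: R_def S_def)
    then show "\<bar>T * y i\<bar> \<le> \<bar>G i\<bar>"
      using k l T by (auto simp: Gk abs_mult intro!: mult_right_mono)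
  qed
  also have "\<dots> \<le> L2_set G {..<n}" by (rule L2_set_subset_le) (use fin in auto)
  also have "\<dots> \<le> N * w" unfolding G_def w_def by (rule N)
  finally have Tv: "T * v \<le> N * w" .
  \<comment> \<open>By \<open>2 * N \<le> T\<close>, the part of \<open>y\<close> on
    \<open>R\<close> has at most half of the norm, so \<open>w\<close> is at most
    \<open>2 * u\<close>. This is the origin of the factor 2 in
    \<open>2 * N\<^sup>2 / T\<close>.\<close>
  have "2 * N * w \<le> T * w" using T(2) w by (intro mult_right_mono) auto
  then have "T * v \<le> T * (w / 2)" using Tv by simp
  then have "v \<le> w / 2" using T by simp
  then have wu: "w \<le> 2 * u" and u: "u > 0" using wuv w by auto
  have "(\<sigma> - \<bar>k\<bar>) * u = L2_set (\<lambda>i. (\<sigma> - \<bar>k\<bar>) * y i) S"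
    using k l by (simp add: L2_set_scale u_def)
  also have "\<dots> \<le> L2_set G S"
  proof (rule L2_set_mono_abs)
    fix i assume "i \<in> S"
    then have "i < n" by (auto simp: S_def)
    then show "\<bar>(\<sigma> - \<bar>k\<bar>) * y i\<bar> \<le> \<bar>G i\<bar>"
      using k l d[of i] by (auto simp: Gk abs_mult intro!: mult_right_mono)
  qed
  also have "\<dots> = L2_set (\<lambda>i. (\<Sum>j\<in>S. F i j * y j) + (\<Sum>j\<in>R. F i j * y j)) S"
    unfolding G_def
    by (rule L2_set_cong, rule sum.union_disjoint[OF fin(1,2,3), unfolded fin(4)])
  also have "\<dots> \<le> L2_set (\<lambda>i. \<Sum>j\<in>S. F i j * y j) S + L2_set (\<lambda>i. \<Sum>j\<in>R. F i j * y j) S"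
    by (rule L2_set_triangle_ineq)
  also have "L2_set (\<lambda>i. \<Sum>j\<in>S. F i j * y j) S \<le> \<Phi> * u"
    unfolding u_def by (rule L2_set_frobenius) (use \<Phi> in auto)
  also have "L2_set (\<lambda>i. \<Sum>j\<in>R. F i j * y j) S \<le> N * v"
  proof -
    \<comment> \<open>Extending \<open>y\<close> by zero off \<open>R\<close> lets the bound
      \<open>N\<close> for the full matrix control the block with rows in \<open>S\<close> and
      columns in \<open>R\<close>.\<close>
    define z where "z j = (if j \<in> R then y j else 0)" for j
    have "(\<Sum>j\<in>R. F i j * y j) = (\<Sum>j<n. F i j * z j)" for i
      using fin by (intro sum.mono_neutral_cong_left) (auto simp: z_def)
    then have "L2_set (\<lambda>i. \<Sum>j\<in>R. F i j * y j) S = L2_set (\<lambda>i. \<Sum>j<n. F i j * z j) S" by simp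
    also have "\<dots> \<le> L2_set (\<lambda>i. \<Sum>j<n. F i j * z j) {..<n}"
      by (rule L2_set_subset_le) (use fin in auto)
    also have "\<dots> \<le> N * L2_set z {..<n}" by (rule N)
    also have "(\<Sum>j<n. (z j)\<^sup>2) = (\<Sum>j\<in>R. (y j)\<^sup>2)"
      using fin by (intro sum.mono_neutral_cong_right) (auto simp: z_def)
    then have "L2_set z {..<n} = v" by (simp add: L2_set_def v_def)
    finally show ?thesis .
  qed
  also have "N * v \<le> 2 * N\<^sup>2 / T * u"
  proof -
    have "v \<le> N * w / T" using Tv T by (simp add: field_simps)
    also have "\<dots> \<le> N * (2 * u) / T"
      using wu N0 T by (intro divide_right_mono mult_left_mono) auto
    finally have "N * v \<le> N * (N * (2 * u) / T)" using N0 by (rule mult_left_mono)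
    then show ?thesis by (simp add: power2_eq_square mult.assoc mult.left_commute)
  qed
  finally have "(\<sigma> - \<bar>k\<bar>) * u \<le> (\<Phi> + 2 * N\<^sup>2 / T) * u" by (simp add: algebra_simps)
  then have "\<sigma> - \<bar>k\<bar> \<le> l" using u \<Phi>(3) by simp
  then show False using k by simp
qed

text \<open>Entry \<open>(i, j)\<close> of \<open>Q\<^sup>T E Q\<close>.\<close>

definition rotated :: "nat \<Rightarrow> real mat \<Rightarrow> real mat \<Rightarrow> nat \<Rightarrow> nat \<Rightarrow> real" where
  "rotated n Q E i j = (\<Sum>k<n. \<Sum>l<n. Q $$ (k, i) * Q $$ (l, j) * E $$ (k, l))"

lemma rotated_app:
  assumes "Q \<in> carrier_mat n n" "i < n"
  shows "(\<Sum>j<n. rotated n Q E i j * x j) = mat_app n (transpose_mat Q) (mat_app n E (mat_app n Q x)) i"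
proof -
  have "(\<Sum>j<n. rotated n Q E i j * x j)
      = (\<Sum>j<n. \<Sum>k<n. \<Sum>l<n. Q $$ (k, i) * E $$ (k, l) * Q $$ (l, j) * x j)"
    unfolding rotated_def sum_distrib_right by (intro sum.cong refl) (simp add: mult_ac)
  also have "\<dots> = (\<Sum>k<n. \<Sum>j<n. \<Sum>l<n. Q $$ (k, i) * E $$ (k, l) * Q $$ (l, j) * x j)"
    by (rule sum.swap)
  also have "\<dots> = (\<Sum>k<n. \<Sum>l<n. \<Sum>j<n. Q $$ (k, i) * E $$ (k, l) * Q $$ (l, j) * x j)"
    by (intro sum.cong refl sum.swap)
  also have "\<dots> = mat_app n (transpose_mat Q) (mat_app n E (mat_app n Q x)) i"
    using assms by (simp add: mat_app_def sum_distrib_left mult.assoc)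
  finally show ?thesis .
qed

lemma transpose_add_symmetric:
  fixes A E :: "real mat"
  assumes "A \<in> carrier_mat n n" "transpose_mat A = A" "E \<in> carrier_mat n n" "transpose_mat E = E"
  shows "A + E \<in> carrier_mat n n" "transpose_mat (A + E) = A + E"
  using assms by (auto simp: transpose_add[of _ n n])

text \<open>With respect to the columns of \<open>Q\<close>, \<open>A\<close> is diagonal and
  \<open>E\<close> becomes \<open>rotated n Q E\<close>, with the same norm bound \<open>N\<close>
  since \<open>Q\<close> is orthogonal. The coordinates \<open>y\<close> of a unit eigenvector of
  \<open>A + E\<close> would then have to vanish.\<close>

lemma least_singular_value_perturb:
  fixes A E :: "real mat"
  assumes n: "n \<ge> 1"
    and Q: "Q \<in> carrier_mat n n" "transpose_mat Q * Q = 1\<^sub>m n" "Q * transpose_mat Q = 1\<^sub>m n"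
    and A: "A = Q * diag n d * transpose_mat Q" "A \<in> carrier_mat n n" "transpose_mat A = A"
    and E: "E \<in> carrier_mat n n" "transpose_mat E = E"
    and N: "\<And>z. L2_set (mat_app n E z) {..<n} \<le> N * L2_set z {..<n}"
    and T: "0 < T" "2 * N \<le> T"
    and S: "S = {i. i < n \<and> \<bar>d i\<bar> < singular_value A n + T}"
    and \<Phi>: "0 \<le> \<Phi>" "(\<Sum>i\<in>S. \<Sum>j\<in>S. (rotated n Q E i j)\<^sup>2) \<le> \<Phi>\<^sup>2" "\<Phi> + 2 * N\<^sup>2 / T \<le> l"
  shows "singular_value A n - l \<le> singular_value (A + E) n"
proof (rule ccontr)
  assume neg: "\<not> ?thesis"
  let ?Qt = "mat_app n (transpose_mat Q)"
  obtain x k where x: "L2_set x {..<n} = 1" "\<And>i. i < n \<Longrightarrow> mat_app n (A + E) x i = k * x i"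
    "\<bar>k\<bar> = singular_value (A + E) n"
    using least_singular_value_eigenvector[OF transpose_add_symmetric[OF A(2,3) E] n] by blast
  define y where "y = ?Qt x"
  have QQ: "mat_app n Q (?Qt z) i = z i" "?Qt (mat_app n Q z) i = z i" if "i < n" for z i
    using Q that mat_app_mult[of Q n "transpose_mat Q" i z] mat_app_mult[of "transpose_mat Q" n Q i z]
    by (auto simp: mat_app_one)
  have "L2_set y {..<n} = 0"
  proof (rule perturbed_diagonal_no_small_eigenvalue[where F = "rotated n Q E" and \<sigma> = "singular_value A n"
      and T = T and N = N and \<Phi> = \<Phi> and l = l and d = d and k = k])
    show "L2_set (\<lambda>i. \<Sum>j<n. rotated n Q E i j * z j) {..<n} \<le> N * L2_set z {..<n}" for z
    proof -
      have "L2_set (\<lambda>i. \<Sum>j<n. rotated n Q E i j * z j) {..<n}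
          = L2_set (?Qt (mat_app n E (mat_app n Q z))) {..<n}"
        by (rule L2_set_cong) (simp add: rotated_app[OF Q(1)])
      also have "\<dots> = L2_set (mat_app n E (mat_app n Q z)) {..<n}"
        by (rule L2_set_orthogonal) (use Q in auto)
      also have "\<dots> \<le> N * L2_set (mat_app n Q z) {..<n}" by (rule N)
      also have "\<dots> = N * L2_set z {..<n}" by (simp add: L2_set_orthogonal[OF Q(1,2)])
      finally show ?thesis .
    qed
    show "singular_value A n \<le> \<bar>d i\<bar>" if "i < n" for i
      by (rule least_singular_value(1)[OF Q A(1,3) n that])
    show "d i * y i + (\<Sum>j<n. rotated n Q E i j * y j) = k * y i" if i: "i < n" for i
    proof -
      have Ax: "mat_app n A x j = mat_app n Q (\<lambda>i. d i * y i) j" if "j < n" for j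
        unfolding A(1) y_def using Q that by (auto simp: mat_app_mult mat_app_diag cong: mat_app_cong)
      have "d i * y i = ?Qt (mat_app n Q (\<lambda>i. d i * y i)) i"
        by (simp add: QQ i)
      also have "\<dots> = ?Qt (mat_app n A x) i"
        by (intro mat_app_cong) (simp add: Ax)
      finally have 1: "d i * y i = ?Qt (mat_app n A x) i" .
      have "(\<Sum>j<n. rotated n Q E i j * y j) = ?Qt (mat_app n E (mat_app n Q y)) i"
        by (rule rotated_app[OF Q(1) i])
      also have "\<dots> = ?Qt (mat_app n E x) i"
        unfolding y_def by (intro mat_app_cong) (simp add: QQ)
      finally have "d i * y i + (\<Sum>j<n. rotated n Q E i j * y j) = ?Qt (\<lambda>j. mat_app n A x j + mat_app n E x j) i"
        unfolding 1 by (simp add: mat_app_def distrib_left sum.distrib)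
      also have "\<dots> = ?Qt (\<lambda>j. k * x j) i"
        by (intro mat_app_cong) (simp add: x(2)[symmetric] mat_app_add[OF A(2) E(1)])
      also have "\<dots> = k * y i"
        by (simp add: y_def mat_app_def sum_distrib_left mult_ac)
      finally show ?thesis .
    qed
  qed (use T \<Phi> neg x(3) S in \<open>auto intro: S\<close>)
  then show False
    using x(1) symmetric_mat_app(2)[OF Q A(1), of x] by (simp add: y_def)
qed

lemma least_singular_value_weyl:
  fixes A E :: "real mat"
  assumes n: "n \<ge> 1"
    and A: "A \<in> carrier_mat n n" "transpose_mat A = A"
    and E: "E \<in> carrier_mat n n" "transpose_mat E = E"
    and N: "\<And>z. L2_set (mat_app n E z) {..<n} \<le> N * L2_set z {..<n}"
  shows "singular_value A n - N \<le> singular_value (A + E) n"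
  unfolding le_least_singular_value_iff[OF transpose_add_symmetric[OF A E] n]
proof
  fix x
  have "singular_value A n * L2_set x {..<n} \<le> L2_set (mat_app n A x) {..<n}"
    using le_least_singular_value_iff[OF A n] by blast
  also have "\<dots> = L2_set (\<lambda>i. mat_app n (A + E) x i + (- 1) * mat_app n E x i) {..<n}"
    by (rule L2_set_cong) (simp add: mat_app_add[OF A(1) E(1)])
  also have "\<dots> \<le> L2_set (mat_app n (A + E) x) {..<n} + L2_set (\<lambda>i. (- 1) * mat_app n E x i) {..<n}"
    by (rule L2_set_triangle_ineq)
  also have "L2_set (\<lambda>i. (- 1) * mat_app n E x i) {..<n} \<le> N * L2_set x {..<n}"
    unfolding L2_set_scale using N by simp
  finally show "(singular_value A n - N) * L2_set x {..<n} \<le> L2_set (mat_app n (A + E) x) {..<n}"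
    by (simp add: algebra_simps)
qed

section \<open>Countable and finite families of test vectors\<close>

text \<open>By continuity rational vectors suffice, and by homogeneity their common denominator can
  be cleared. Lists are used because \<open>int list\<close> is a countable type, which makes the
  event measurable; entries \<open>zs ! i\<close> out of range are just further integers.\<close>

lemma le_least_singular_value_iff_int:
  assumes A: "A \<in> carrier_mat n n" "transpose_mat A = A" and n: "n \<ge> 1"
  shows "s \<le> singular_value A n \<longleftrightarrow>
    (\<forall>zs :: int list. s * L2_set (\<lambda>i. real_of_int (zs ! i)) {..<n}
       \<le> L2_set (mat_app n A (\<lambda>i. real_of_int (zs ! i))) {..<n})"
  unfolding le_least_singular_value_iff[OF assms]
proof (intro iffI allI)
  fix x :: "nat \<Rightarrow> real"
  assume int: "\<forall>zs :: int list. s * L2_set (\<lambda>i. real_of_int (zs ! i)) {..<n}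
       \<le> L2_set (mat_app n A (\<lambda>i. real_of_int (zs ! i))) {..<n}"
  define q where "q m i = real_of_int \<lfloor>real m * x i\<rfloor> / real m" for m i
  have q: "(\<lambda>m. q m i) \<longlonglongrightarrow> x i" for i
  proof (rule tendsto_sandwich)
    show "\<forall>\<^sub>F m in sequentially. x i - 1 / real m \<le> q m i"
      using eventually_gt_at_top[of 0]
    proof eventually_elim
      case (elim m)
      have "real m * x i - 1 \<le> real_of_int \<lfloor>real m * x i\<rfloor>" by linarith
      then have "(real m * x i - 1) / real m \<le> q m i" unfolding q_def by (rule divide_right_mono) simp
      then show ?case using elim by (simp add: diff_divide_distrib)
    qed
    show "\<forall>\<^sub>F m in sequentially. q m i \<le> x i"
      using eventually_gt_at_top[of 0]
    proof eventually_elim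
      case (elim m)
      have "real_of_int \<lfloor>real m * x i\<rfloor> \<le> real m * x i" by linarith
      then show ?case using elim by (simp add: q_def field_simps)
    qed
    show "(\<lambda>m. x i - 1 / real m) \<longlonglongrightarrow> x i"
      using tendsto_diff[OF tendsto_const lim_1_over_n, of "x i"] by simp
  qed simp
  have "s * L2_set (q m) {..<n} \<le> L2_set (mat_app n A (q m)) {..<n}" if "m \<ge> 1" for m
  proof -
    define zs where "zs = map (\<lambda>i. \<lfloor>real m * x i\<rfloor>) [0..<n]"
    have zs: "q m i = 1 / real m * real_of_int (zs ! i)" if "i < n" for i
      using that by (simp add: zs_def q_def)
    have "mat_app n A (q m) i = 1 / real m * mat_app n A (\<lambda>i. real_of_int (zs ! i)) i" for i
      unfolding mat_app_def sum_distrib_left by (intro sum.cong refl) (simp add: zs)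
    then have "L2_set (mat_app n A (q m)) {..<n}
        = L2_set (\<lambda>i. 1 / real m * mat_app n A (\<lambda>i. real_of_int (zs ! i)) i) {..<n}"
      by (intro L2_set_cong)
    then have "L2_set (mat_app n A (q m)) {..<n}
        = 1 / real m * L2_set (mat_app n A (\<lambda>i. real_of_int (zs ! i))) {..<n}"
      unfolding L2_set_scale by simp
    moreover have "L2_set (q m) {..<n} = 1 / real m * L2_set (\<lambda>i. real_of_int (zs ! i)) {..<n}"
    proof -
      have "L2_set (q m) {..<n} = L2_set (\<lambda>i. 1 / real m * real_of_int (zs ! i)) {..<n}"
        by (rule L2_set_cong) (simp add: zs)
      then show ?thesis by (simp only: L2_set_scale) simp
    qed
    ultimately show ?thesis
      using mult_left_mono[OF int[rule_format, of zs], of "1 / real m"] that by (simp add: mult_ac)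
  qed
  moreover have "(\<lambda>m. s * L2_set (q m) {..<n}) \<longlonglongrightarrow> s * L2_set x {..<n}"
    unfolding L2_set_def by (intro tendsto_intros q)
  moreover have "(\<lambda>m. L2_set (mat_app n A (q m)) {..<n}) \<longlonglongrightarrow> L2_set (mat_app n A x) {..<n}"
    unfolding L2_set_def mat_app_def by (intro tendsto_intros q)
  ultimately show "s * L2_set x {..<n} \<le> L2_set (mat_app n A x) {..<n}"
    by (intro LIMSEQ_le) auto
qed auto

text \<open>Divided by \<open>2 \<surd>n\<close>, these integer vectors form a \<open>1 / 4\<close>-net of the unit sphere.\<close>

definition grid :: "nat \<Rightarrow> (nat \<Rightarrow> int) set" where
  "grid n = {z \<in> extensional {..<n}. (\<Sum>i<n. (real_of_int (z i))\<^sup>2) \<le> 7 * real n}"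

definition quad :: "nat \<Rightarrow> real mat \<Rightarrow> (nat \<Rightarrow> real) \<Rightarrow> real" where
  "quad n E x = (\<Sum>i<n. \<Sum>j<n. x i * x j * E $$ (i, j))"

lemma quad_eq: "quad n E x = (\<Sum>i<n. x i * mat_app n E x i)"
  by (simp add: quad_def mat_app_def sum_distrib_left mult_ac)

text \<open>Near a top eigenvector \<open>x\<close> with eigenvalue \<open>k\<close>, the form at a
  net point \<open>x + h\<close> is \<open>k\<close>, plus \<open>2 * k\<close> times the inner
  product of \<open>h\<close> and \<open>x\<close>, plus the form at \<open>h\<close>. With
  \<open>h\<close> of norm at most 1 / 4 the corrections are at most
  \<open>\<bar>k\<bar> / 2\<close> and \<open>\<bar>k\<bar> / 16\<close>, so 7 / 16 of
  \<open>\<bar>k\<bar>\<close> survives. Scaling back by \<open>4 * n\<close> turns this into 7 / 4,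
  more than the bound asks for.\<close>

lemma operator_norm_le_grid:
  assumes E: "E \<in> carrier_mat n n" "transpose_mat E = E" and n: "n \<ge> 1"
    and b: "\<And>z. z \<in> grid n \<Longrightarrow> \<bar>quad n E (\<lambda>i. real_of_int (z i))\<bar> \<le> b * real n"
  shows "L2_set (mat_app n E w) {..<n} \<le> b * L2_set w {..<n}"
proof -
  obtain x k where x: "L2_set x {..<n} = 1" "\<And>i. i < n \<Longrightarrow> mat_app n E x i = k * x i"
    "\<And>z. L2_set (mat_app n E z) {..<n} \<le> \<bar>k\<bar> * L2_set z {..<n}"
    using symmetric_top_eigenvector[OF E n] by blast
  \<comment> \<open>Rounding errs by at most 1 / 2 per coordinate, hence by at most
    \<open>sqrt n / 2\<close> in norm; division by this \<open>a\<close> leaves 1 / 4.\<close>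
  define a where "a = 2 * sqrt (real n)"
  have a: "a > 0" "a\<^sup>2 = 4 * real n" using n by (auto simp: a_def power_mult_distrib)
  define z where "z = restrict (\<lambda>i. round (a * x i)) {..<n}"
  define h where "h i = real_of_int (z i) / a - x i" for i
  have h_le: "\<bar>h i\<bar> \<le> 1 / (2 * a)" if "i < n" for i
  proof -
    have "\<bar>real_of_int (z i) - a * x i\<bar> \<le> 1 / 2"
      using that of_int_round_abs_le[of "a * x i"] by (simp add: z_def)
    moreover have "a * h i = real_of_int (z i) - a * x i" using a by (simp add: h_def algebra_simps)
    moreover have "\<bar>a * h i\<bar> = a * \<bar>h i\<bar>" using a by (simp add: abs_mult)
    ultimately have "a * \<bar>h i\<bar> \<le> 1 / 2" by simp
    then show ?thesis using a by (simp add: field_simps)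
  qed
  have "L2_set h {..<n} \<le> L2_set (\<lambda>_. 1 / (2 * a)) {..<n}"
    using h_le a by (intro L2_set_mono_abs) auto
  also have "\<dots> = sqrt (real n * (1 / (2 * a))\<^sup>2)" by (simp add: L2_set_def)
  also have "real n * (1 / (2 * a))\<^sup>2 = (1 / 4)\<^sup>2"
    using n a by (simp add: power_divide power_mult_distrib)
  finally have h: "L2_set h {..<n} \<le> 1 / 4" by simp
  have zh: "real_of_int (z i) = a * (x i + h i)" for i using a by (simp add: h_def)
  have xh: "L2_set (\<lambda>i. x i + h i) {..<n} \<le> 5 / 4"
    using L2_set_triangle_ineq[of x h "{..<n}"] h x(1) by simp
  have "sqrt (\<Sum>i<n. (real_of_int (z i))\<^sup>2) = L2_set (\<lambda>i. a * (x i + h i)) {..<n}"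
    by (simp add: L2_set_def zh)
  also have "\<dots> \<le> a * (5 / 4)" using xh a by (simp only: L2_set_scale) simp
  finally have "(\<Sum>i<n. (real_of_int (z i))\<^sup>2) \<le> (a * (5 / 4))\<^sup>2"
    by (rule sqrt_le_D)
  \<comment> \<open>The left side is \<open>4 * n * 25 / 16\<close>, that is, 6.25 times
    \<open>n\<close>; rounding up gives the 7 in \<open>grid\<close>.\<close>
  also have "\<dots> \<le> 7 * real n" by (simp add: power_mult_distrib a power_divide)
  finally have "z \<in> grid n" by (auto simp: grid_def z_def)
  then have "\<bar>quad n E (\<lambda>i. real_of_int (z i))\<bar> \<le> b * real n" by (rule b)
  moreover have "quad n E (\<lambda>i. real_of_int (z i)) = 4 * real n * quad n E (\<lambda>i. x i + h i)"
    unfolding a(2)[symmetric] zh quad_def by (simp add: sum_distrib_left power2_eq_square mult_ac)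
  moreover have "quad n E (\<lambda>i. x i + h i) = k + 2 * k * (\<Sum>i<n. h i * x i) + quad n E h"
  proof -
    have kx: "(\<Sum>i<n. f i * mat_app n E x i) = k * (\<Sum>i<n. f i * x i)" for f
      unfolding sum_distrib_left by (intro sum.cong refl) (simp add: x(2))
    have "(\<Sum>i<n. x i * x i) = 1"
      using x(1) by (simp add: L2_set_def power2_eq_square)
    then have xx: "(\<Sum>i<n. x i * mat_app n E x i) = k" unfolding kx by simp
    have hx: "(\<Sum>i<n. h i * mat_app n E x i) = k * (\<Sum>i<n. h i * x i)" by (rule kx)
    have "(\<Sum>i<n. x i * mat_app n E h i) = (\<Sum>i<n. h i * mat_app n E x i)"
      using mat_app_adjoint[OF E(1), of x h] by (simp add: E(2) mult.commute)
    then have xh: "(\<Sum>i<n. x i * mat_app n E h i) = k * (\<Sum>i<n. h i * x i)" by (simp add: hx)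
    have "mat_app n E (\<lambda>i. x i + h i) i = mat_app n E x i + mat_app n E h i" for i
      by (simp add: mat_app_def distrib_left sum.distrib)
    then have "quad n E (\<lambda>i. x i + h i) = (\<Sum>i<n. x i * mat_app n E x i) + (\<Sum>i<n. h i * mat_app n E x i)
        + (\<Sum>i<n. x i * mat_app n E h i) + (\<Sum>i<n. h i * mat_app n E h i)"
      unfolding quad_eq by (simp add: algebra_simps sum.distrib)
    then show ?thesis unfolding xx hx xh quad_eq by simp
  qed
  moreover have "\<bar>2 * k * (\<Sum>i<n. h i * x i)\<bar> \<le> \<bar>k\<bar> / 2"
  proof -
    have "\<bar>\<Sum>i<n. h i * x i\<bar> \<le> 1 / 4"
      using L2_set_bilinear_le[of h x "{..<n}"] h x(1) by simp
    then have "2 * \<bar>k\<bar> * \<bar>\<Sum>i<n. h i * x i\<bar> \<le> 2 * \<bar>k\<bar> * (1 / 4)"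
      by (intro mult_left_mono) auto
    then show ?thesis by (simp add: abs_mult)
  qed
  moreover have "\<bar>quad n E h\<bar> \<le> \<bar>k\<bar> / 16"
  proof -
    have "\<bar>quad n E h\<bar> \<le> L2_set h {..<n} * L2_set (mat_app n E h) {..<n}"
      unfolding quad_eq by (rule L2_set_bilinear_le)
    also have "\<dots> \<le> L2_set h {..<n} * (\<bar>k\<bar> * L2_set h {..<n})"
      by (intro mult_left_mono x(3) L2_set_nonneg)
    also have "\<dots> \<le> 1 / 4 * (\<bar>k\<bar> * (1 / 4))"
      using h by (intro mult_mono mult_left_mono) auto
    finally show ?thesis by simp
  qed
  ultimately have "4 * real n * \<bar>quad n E (\<lambda>i. x i + h i)\<bar> \<le> b * real n"
    and "\<bar>quad n E (\<lambda>i. x i + h i)\<bar> \<ge> 7 / 16 * \<bar>k\<bar>"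
    by (simp add: abs_mult, linarith)
  then have "\<bar>k\<bar> \<le> b" using n by (simp add: field_simps)
  then have "\<bar>k\<bar> * L2_set w {..<n} \<le> b * L2_set w {..<n}"
    by (intro mult_right_mono L2_set_nonneg)
  then show ?thesis using x(3)[of w] by simp
qed

lemma sum_half_power_abs: "(\<Sum>k\<in>{-int m..int m}. (1 / 2 :: real) ^ nat \<bar>k\<bar>) \<le> 3"
proof -
  have "(\<Sum>k\<in>{-int m..int m}. (1 / 2 :: real) ^ nat \<bar>k\<bar>) = 3 - 2 * (1 / 2) ^ m"
  proof (induction m)
    case (Suc m)
    have "{-int (Suc m)..int (Suc m)} = insert (int (Suc m)) (insert (- int (Suc m)) {-int m..int m})"
      by auto
    then show ?case using Suc by (simp add: nat_add_distrib)
  qed simp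
  then show ?thesis by simp
qed

text \<open>Each grid point is counted with the weight \<open>2 ^ (7 n - \<Sum>i. \<bar>z i\<bar>) \<ge> 1\<close>, whose sum factorises.\<close>

lemma card_grid: "finite (grid n)" "real (card (grid n)) \<le> 384 ^ n"
proof -
  let ?B = "PiE {..<n} (\<lambda>_. {-int (7 * n)..int (7 * n)})"
  \<comment> \<open>The modulus of an integer is at most its square, so the quadratic constraint
    bounds the sum of the moduli, which a product weight can measure.\<close>
  have abs_le: "real_of_int \<bar>k\<bar> \<le> (real_of_int k)\<^sup>2" for k
  proof -
    have "\<bar>k\<bar> \<le> k\<^sup>2" using self_le_power[of "\<bar>k\<bar>" 2] by (cases "k = 0") auto
    then have "real_of_int \<bar>k\<bar> \<le> real_of_int (k\<^sup>2)" by (simp only: of_int_le_iff)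
    then show ?thesis by simp
  qed
  have sum_abs: "(\<Sum>i<n. nat \<bar>z i\<bar>) \<le> 7 * n" if "z \<in> grid n" for z
  proof -
    have "real (\<Sum>i<n. nat \<bar>z i\<bar>) = (\<Sum>i<n. real_of_int \<bar>z i\<bar>)" by simp
    also have "\<dots> \<le> (\<Sum>i<n. (real_of_int (z i))\<^sup>2)" by (intro sum_mono abs_le)
    also have "\<dots> \<le> 7 * real n" using that by (simp add: grid_def)
    finally show ?thesis by linarith
  qed
  have sub: "grid n \<subseteq> ?B"
  proof
    fix z assume z: "z \<in> grid n"
    have "nat \<bar>z i\<bar> \<le> 7 * n" if "i < n" for i
      using member_le_sum[of i "{..<n}" "\<lambda>i. nat \<bar>z i\<bar>"] that sum_abs[OF z] by auto
    then have "z i \<in> {-int (7 * n)..int (7 * n)}" if "i < n" for i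
      using that by fastforce
    then show "z \<in> ?B" using z by (auto simp: grid_def PiE_def)
  qed
  have fin: "finite ?B" by (intro finite_PiE) auto
  show "finite (grid n)" using sub fin by (rule finite_subset)
  have "real (card (grid n)) = (\<Sum>z\<in>grid n. 1)" by simp
  also have "\<dots> \<le> (\<Sum>z\<in>grid n. 2 ^ (7 * n) * (\<Prod>i<n. (1 / 2) ^ nat \<bar>z i\<bar>))"
  proof (rule sum_mono)
    fix z assume z: "z \<in> grid n"
    have "(1 :: real) = 2 ^ (7 * n) * (1 / 2) ^ (7 * n)" by (simp add: power_divide)
    also have "\<dots> \<le> 2 ^ (7 * n) * (1 / 2) ^ (\<Sum>i<n. nat \<bar>z i\<bar>)"
      by (intro mult_left_mono power_decreasing sum_abs[OF z]) auto
    finally show "1 \<le> 2 ^ (7 * n) * (\<Prod>i<n. (1 / 2 :: real) ^ nat \<bar>z i\<bar>)"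
      by (simp add: power_sum)
  qed
  also have "\<dots> \<le> (\<Sum>z\<in>?B. 2 ^ (7 * n) * (\<Prod>i<n. (1 / 2) ^ nat \<bar>z i\<bar>))"
    using sub fin by (intro sum_mono2) (auto intro!: prod_nonneg mult_nonneg_nonneg)
  also have "\<dots> = 2 ^ (7 * n) * (\<Prod>i<n. \<Sum>k\<in>{-int (7 * n)..int (7 * n)}. (1 / 2) ^ nat \<bar>k\<bar>)"
    by (subst prod_sum_PiE) (auto simp: sum_distrib_left)
  also have "\<dots> \<le> 2 ^ (7 * n) * (\<Prod>i<n. 3)"
    by (intro mult_left_mono prod_mono conjI sum_nonneg sum_half_power_abs) auto
  \<comment> \<open>Per coordinate, \<open>2 ^ 7\<close> comes from the weight and 3 from the
    two-sided geometric series.\<close>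
  also have "\<dots> = (384 :: real) ^ n"
    by (simp add: power_mult flip: power_mult_distrib)
  finally show "real (card (grid n)) \<le> 384 ^ n" .
qed

section \<open>Moment generating functions of sub-Gaussian variables and matrices\<close>

text \<open>The infimum in the norm need not be attained. Passing from \<open>C\<close> to
  \<open>2 * C\<close> leaves room for an admissible \<open>c\<close> below it, and the integrand
  decreases in \<open>c\<close>.\<close>

lemma psi2_norm_exp_square:
  assumes "psi2_norm M X \<le> ennreal C" "C > 0"
  shows "(\<integral>\<^sup>+\<omega>. ennreal (exp ((X \<omega>)\<^sup>2 / (2 * C)\<^sup>2)) \<partial>M) \<le> 2"
proof -
  have "psi2_norm M X < ennreal (2 * C)"
    using assms by (intro le_less_trans[OF assms(1)]) (simp add: ennreal_less_iff)
  then obtain c where c: "c > 0" "(\<integral>\<^sup>+\<omega>. ennreal (exp ((X \<omega>)\<^sup>2 / c\<^sup>2)) \<partial>M) < 2" "ennreal c < ennreal (2 * C)"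
    unfolding psi2_norm_def Inf_less_iff by blast
  then have "c < 2 * C" by (simp add: ennreal_less_iff)
  then have "c\<^sup>2 \<le> (2 * C)\<^sup>2" using c by (intro power_mono) auto
  then have "(\<integral>\<^sup>+\<omega>. ennreal (exp ((X \<omega>)\<^sup>2 / (2 * C)\<^sup>2)) \<partial>M) \<le> (\<integral>\<^sup>+\<omega>. ennreal (exp ((X \<omega>)\<^sup>2 / c\<^sup>2)) \<partial>M)"
    using c by (intro nn_integral_mono ennreal_leI) (auto intro!: divide_left_mono mult_pos_pos)
  then show ?thesis using c(2) by simp
qed

text \<open>The linear term stays exact, so that its mean vanishes for a centered variable;
  everything else is charged to \<open>exp (x\<^sup>2)\<close>.\<close>

lemma exp_le_self_add_exp_square: "exp x \<le> x + exp (x\<^sup>2)" for x :: real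
proof -
  have sq: "1 + x\<^sup>2 \<le> exp (x\<^sup>2)" by (rule exp_ge_add_one_self)
  consider "x \<ge> 1" | "0 \<le> x" "x \<le> 1" | "x \<le> 0" by linarith
  then show ?thesis
  proof cases
    case 1
    then have "x \<le> x\<^sup>2" by (simp add: power2_eq_square)
    then have "exp x \<le> exp (x\<^sup>2)" by simp
    then show ?thesis using 1 by linarith
  next
    case 2
    then show ?thesis using exp_bound[of x] sq by linarith
  next
    case 3
    let ?y = "- x"
    \<comment> \<open>The Taylor bound for \<open>exp ?y\<close> becomes an upper bound for
      \<open>exp x\<close> after multiplication by \<open>1 - ?y + ?y\<^sup>2 / 2\<close>, since the
      product of the two polynomials is \<open>1 + ?y ^ 4 / 4\<close>.\<close>
    have "1 + ?y + ?y\<^sup>2 / 2 \<le> exp ?y" using 3 by (intro exp_lower_Taylor_quadratic) simp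
    then have "(1 - ?y + ?y\<^sup>2 / 2) * (1 + ?y + ?y\<^sup>2 / 2) \<le> (1 - ?y + ?y\<^sup>2 / 2) * exp ?y"
      using 3 zero_le_power2[of "x + 1"] by (intro mult_left_mono) (auto simp: power2_sum)
    moreover have "(1 - ?y + ?y\<^sup>2 / 2) * (1 + ?y + ?y\<^sup>2 / 2) = 1 + (?y\<^sup>2 / 2)\<^sup>2"
      by (simp add: power2_eq_square algebra_simps)
    ultimately have "1 + (?y\<^sup>2 / 2)\<^sup>2 \<le> (1 - ?y + ?y\<^sup>2 / 2) * exp ?y" by argo
    then have "1 \<le> (1 - ?y + ?y\<^sup>2 / 2) * exp ?y"
      by (rule order.trans[rotated]) simp
    moreover have "exp x * exp ?y = 1" by (simp flip: exp_add)
    ultimately have "exp x * exp ?y \<le> (1 - ?y + ?y\<^sup>2 / 2) * exp ?y" by simp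
    then have "exp x \<le> 1 - ?y + ?y\<^sup>2 / 2" by simp
    then have "exp x \<le> 1 + x + x\<^sup>2 / 2" by simp
    then show ?thesis using sq zero_le_power2[of x] by linarith
  qed
qed

text \<open>Convexity of the exponential between 0 and \<open>s\<close>. After division by
  \<open>exp (\<theta> * s)\<close> it is a weighted sum of two tangent bounds
  \<open>1 + u \<le> exp u\<close> whose linear terms cancel.\<close>

lemma exp_scale_le:
  fixes s \<theta> :: real
  assumes "0 \<le> \<theta>" "\<theta> \<le> 1"
  shows "exp (\<theta> * s) \<le> 1 - \<theta> + \<theta> * exp s"
proof -
  have "(1 - \<theta>) * (1 + (- \<theta> * s)) + \<theta> * (1 + (1 - \<theta>) * s) \<le> (1 - \<theta>) * exp (- \<theta> * s) + \<theta> * exp ((1 - \<theta>) * s)"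
    using assms by (intro add_mono mult_left_mono exp_ge_add_one_self) auto
  then have "1 \<le> (1 - \<theta>) * exp (- \<theta> * s) + \<theta> * exp ((1 - \<theta>) * s)" by (simp add: algebra_simps)
  then have "exp (\<theta> * s) * 1 \<le> exp (\<theta> * s) * ((1 - \<theta>) * exp (- \<theta> * s) + \<theta> * exp ((1 - \<theta>) * s))"
    by (intro mult_left_mono) auto
  also have "\<dots> = (1 - \<theta>) * exp (\<theta> * s + - \<theta> * s) + \<theta> * exp (\<theta> * s + (1 - \<theta>) * s)"
    unfolding exp_add by (simp add: algebra_simps)
  also have "\<dots> = 1 - \<theta> + \<theta> * exp s" by (simp add: algebra_simps)
  finally show ?thesis by simp
qed

text \<open>The majorant consists of functions with controlled means: \<open>x\<close> will have
  mean 0 and \<open>exp (x\<^sup>2 / c\<^sup>2)\<close> mean at most 2, whence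
  \<open>\<beta> + 2 * \<gamma>\<close>. For small \<open>t\<close> the two preceding bounds
  combine. For large \<open>t\<close> there is no linear term: Young's inequality suffices, as
  \<open>exp (c\<^sup>2 * t\<^sup>2 / 2)\<close> is then at least 3 / 2.\<close>

lemma exp_le_affine_exp_square:
  fixes t c :: real
  assumes "c > 0"
  obtains \<alpha> \<beta> \<gamma> where "\<gamma> \<ge> 0" "\<beta> + 2 * \<gamma> \<le> exp (c\<^sup>2 * t\<^sup>2)"
    "\<And>x. exp (t * x) \<le> \<alpha> * x + \<beta> + \<gamma> * exp (x\<^sup>2 / c\<^sup>2)"
proof (cases "c\<^sup>2 * t\<^sup>2 \<le> 1")
  case True
  show ?thesis
  proof (rule that[of "c\<^sup>2 * t\<^sup>2" "1 - c\<^sup>2 * t\<^sup>2" t])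
    show "1 - c\<^sup>2 * t\<^sup>2 + 2 * (c\<^sup>2 * t\<^sup>2) \<le> exp (c\<^sup>2 * t\<^sup>2)"
      using exp_ge_add_one_self[of "c\<^sup>2 * t\<^sup>2"] by linarith
    fix x
    have "exp (t * x) \<le> t * x + exp ((t * x)\<^sup>2)" by (rule exp_le_self_add_exp_square)
    also have "(t * x)\<^sup>2 = c\<^sup>2 * t\<^sup>2 * (x\<^sup>2 / c\<^sup>2)" using assms by (simp add: power_mult_distrib)
    also have "exp (c\<^sup>2 * t\<^sup>2 * (x\<^sup>2 / c\<^sup>2)) \<le> 1 - c\<^sup>2 * t\<^sup>2 + c\<^sup>2 * t\<^sup>2 * exp (x\<^sup>2 / c\<^sup>2)"
      using True by (intro exp_scale_le) auto
    finally show "exp (t * x) \<le> t * x + (1 - c\<^sup>2 * t\<^sup>2) + c\<^sup>2 * t\<^sup>2 * exp (x\<^sup>2 / c\<^sup>2)" by simp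
  qed simp
next
  case False
  define g where "g = exp (c\<^sup>2 * t\<^sup>2 / 2)"
  show ?thesis
  proof (rule that[of "g / 2" "g / 2" 0])
    have "3 / 2 \<le> exp (c\<^sup>2 * t\<^sup>2 / 2)"
      using exp_ge_add_one_self[of "c\<^sup>2 * t\<^sup>2 / 2"] False by linarith
    then have "3 / 2 * g \<le> g * g" by (simp add: g_def)
    also have "g * g = exp (c\<^sup>2 * t\<^sup>2)" by (simp add: g_def flip: exp_add)
    finally show "g / 2 + 2 * (g / 2) \<le> exp (c\<^sup>2 * t\<^sup>2)" by simp
    fix x
    have "0 \<le> (t * c - x / c)\<^sup>2" by simp
    then have "2 * (t * x) \<le> c\<^sup>2 * t\<^sup>2 + x\<^sup>2 / c\<^sup>2"
      using assms by (simp add: power2_diff power_mult_distrib power_divide mult_ac)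
    then have "t * x \<le> c\<^sup>2 * t\<^sup>2 / 2 + 1 / 2 * (x\<^sup>2 / c\<^sup>2)" by linarith
    then have "exp (t * x) \<le> g * exp (1 / 2 * (x\<^sup>2 / c\<^sup>2))"
      unfolding g_def exp_add[symmetric] by simp
    also have "\<dots> \<le> g * (1 - 1 / 2 + 1 / 2 * exp (x\<^sup>2 / c\<^sup>2))"
      by (intro mult_left_mono exp_scale_le) (auto simp: g_def)
    finally show "exp (t * x) \<le> 0 * x + g / 2 + g / 2 * exp (x\<^sup>2 / c\<^sup>2)" by (simp add: algebra_simps)
  qed (simp add: g_def)
qed

lemma sub_gaussian_mgf:
  assumes M: "prob_space M" and X: "has_bochner_integral M X 0" and c: "c > 0"
    and sq: "(\<integral>\<^sup>+\<omega>. ennreal (exp ((X \<omega>)\<^sup>2 / c\<^sup>2)) \<partial>M) \<le> 2"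
  shows "(\<integral>\<^sup>+\<omega>. ennreal (exp (t * X \<omega>)) \<partial>M) \<le> ennreal (exp (c\<^sup>2 * t\<^sup>2))"
proof -
  interpret prob_space M by (rule M)
  have [measurable]: "X \<in> borel_measurable M" using X by (rule has_bochner_integral.cases) auto
  define Y where "Y \<omega> = exp ((X \<omega>)\<^sup>2 / c\<^sup>2)" for \<omega>
  have [measurable]: "Y \<in> borel_measurable M" unfolding Y_def by measurable
  have "(\<integral>\<^sup>+\<omega>. ennreal (Y \<omega>) \<partial>M) < \<infinity>"
    using sq unfolding Y_def by (rule le_less_trans) simp
  then have intY: "integrable M Y"
    by (intro integrableI_nonneg) (auto simp: Y_def)
  have "ennreal (integral\<^sup>L M Y) \<le> 2"
    using sq nn_integral_eq_integral[OF intY] by (simp add: Y_def)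
  then have Y2: "integral\<^sup>L M Y \<le> 2"
    by (metis ennreal_le_iff ennreal_numeral zero_le_numeral)
  obtain \<alpha> \<beta> \<gamma> where g: "\<gamma> \<ge> 0" "\<beta> + 2 * \<gamma> \<le> exp (c\<^sup>2 * t\<^sup>2)"
    "\<And>x. exp (t * x) \<le> \<alpha> * x + \<beta> + \<gamma> * exp (x\<^sup>2 / c\<^sup>2)"
    using exp_le_affine_exp_square[OF c] by metis
  define f where "f \<omega> = \<alpha> * X \<omega> + \<beta> + \<gamma> * Y \<omega>" for \<omega>
  have intX: "integrable M X" "integral\<^sup>L M X = 0"
    using X by (auto simp: has_bochner_integral_iff)
  have f: "exp (t * X \<omega>) \<le> f \<omega>" for \<omega> by (simp add: f_def Y_def g(3))
  have intf: "integrable M f" unfolding f_def using intX(1) intY by auto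
  have "integral\<^sup>L M f = \<beta> + \<gamma> * integral\<^sup>L M Y"
    unfolding f_def using intX intY by (simp add: prob_space)
  also have "\<dots> \<le> \<beta> + \<gamma> * 2" using g(1) Y2 by (intro add_left_mono mult_left_mono)
  finally have "integral\<^sup>L M f \<le> exp (c\<^sup>2 * t\<^sup>2)" using g(2) by simp
  have "(\<integral>\<^sup>+\<omega>. ennreal (exp (t * X \<omega>)) \<partial>M) \<le> (\<integral>\<^sup>+\<omega>. ennreal (f \<omega>) \<partial>M)"
    by (intro nn_integral_mono ennreal_leI f)
  also have "\<dots> = ennreal (integral\<^sup>L M f)"
    by (intro nn_integral_eq_integral intf AE_I2) (rule order.trans[OF _ f], simp)
  also have "\<dots> \<le> ennreal (exp (c\<^sup>2 * t\<^sup>2))" by (rule ennreal_leI) fact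
  finally show ?thesis .
qed

text \<open>Independence holds only among the entries on and above the diagonal, so linear forms in
  all entries are regrouped over that index set.\<close>

lemma sum_square_upper_triangle:
  fixes f :: "nat \<Rightarrow> nat \<Rightarrow> real"
  shows "(\<Sum>i<n. \<Sum>j<n. f i j) =
    (\<Sum>(i, j)\<in>{(i, j). i \<le> j \<and> j < n}. if i = j then f i i else f i j + f j i)"
proof -
  let ?U = "{(i, j). i \<le> j \<and> j < n}" and ?V = "{(i, j). i < j \<and> j < n}" and ?W = "{(i, j). j < i \<and> i < n}"
  have fin: "finite ?U" "finite ?V" "finite ?W"
    by (rule finite_subset[of _ "{..<n} \<times> {..<n}"]; force)+
  have "(\<Sum>i<n. \<Sum>j<n. f i j) = (\<Sum>(i, j)\<in>{..<n} \<times> {..<n}. f i j)"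
    by (simp add: sum.cartesian_product)
  also have "{..<n} \<times> {..<n} = ?U \<union> ?W" by auto
  also have "(\<Sum>(i, j)\<in>?U \<union> ?W. f i j) = (\<Sum>(i, j)\<in>?U. f i j) + (\<Sum>(i, j)\<in>?W. f i j)"
    using fin by (intro sum.union_disjoint) auto
  also have "(\<Sum>(i, j)\<in>?W. f i j) = (\<Sum>(i, j)\<in>?V. f j i)"
    by (rule sum.reindex_bij_witness[of _ prod.swap prod.swap]) auto
  also have "\<dots> = (\<Sum>(i, j)\<in>?U. if i = j then 0 else f j i)"
    using fin by (intro sum.mono_neutral_cong_left) (auto split: if_splits)
  also have "(\<Sum>(i, j)\<in>?U. f i j) + \<dots> = (\<Sum>(i, j)\<in>?U. if i = j then f i i else f i j + f j i)"
    unfolding sum.distrib[symmetric] by (intro sum.cong) auto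
  finally show ?thesis .
qed

lemma sub_gaussian_matrix_entry:
  assumes "sub_gaussian_matrix C1 C2 n M E" "i < n" "j < n"
  shows "(\<lambda>\<omega>. E \<omega> $$ (i, j)) \<in> borel_measurable M"
proof -
  have "has_bochner_integral M (\<lambda>\<omega>. E \<omega> $$ (i, j)) 0"
    using assms by (simp add: sub_gaussian_matrix_def)
  then show ?thesis by (rule has_bochner_integral.cases) auto
qed

text \<open>The constant \<open>8 * C2\<^sup>2\<close> is \<open>(2 * C2)\<^sup>2\<close> for each
  independent entry, times 2 from
  \<open>(x + y)\<^sup>2 \<le> 2 * x\<^sup>2 + 2 * y\<^sup>2\<close>, since off the diagonal the two
  coefficients of one variable add up.\<close>

lemma sub_gaussian_matrix_mgf:
  assumes M: "prob_space M" and E: "sub_gaussian_matrix C1 C2 n M E" and C2: "C2 > 0"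
  shows "(\<integral>\<^sup>+\<omega>. ennreal (exp (\<Sum>i<n. \<Sum>j<n. a i j * E \<omega> $$ (i, j))) \<partial>M)
    \<le> ennreal (exp (8 * C2\<^sup>2 * (\<Sum>i<n. \<Sum>j<n. (a i j)\<^sup>2)))"
proof -
  interpret prob_space M by (rule M)
  let ?U = "{(i, j). i \<le> j \<and> j < n}"
  have fin: "finite ?U"
    by (rule finite_subset[of _ "{..<n} \<times> {..<n}"]; force)
  define b where "b p = (case p of (i, j) \<Rightarrow> if i = j then a i i else a i j + a j i)" for p
  have sum: "(\<Sum>i<n. \<Sum>j<n. a i j * E \<omega> $$ (i, j)) = (\<Sum>p\<in>?U. b p * E \<omega> $$ p)" if "\<omega> \<in> space M" for \<omega>
  proof -
    have "E \<omega> $$ (i, j) = E \<omega> $$ (j, i)" if "i < n" "j < n" for i j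
      using E \<open>\<omega> \<in> space M\<close> that by (intro symmetric_mat_entry[of _ n]) (auto simp: sub_gaussian_matrix_def)
    then show ?thesis
      unfolding sum_square_upper_triangle
      by (intro sum.cong) (auto simp: b_def distrib_right)
  qed
  have indep: "indep_vars (\<lambda>_. borel) (\<lambda>p \<omega>. ennreal (exp (b p * E \<omega> $$ p))) ?U"
  proof -
    have "indep_vars (\<lambda>_. borel) (\<lambda>p \<omega>. E \<omega> $$ p) ?U"
      using E unfolding sub_gaussian_matrix_def by (simp add: case_prod_beta')
    from indep_vars_compose2[OF this, of "\<lambda>p x. ennreal (exp (b p * x))" "\<lambda>_. borel"]
    show ?thesis by simp
  qed
  have one: "(\<integral>\<^sup>+\<omega>. ennreal (exp (b p * E \<omega> $$ p)) \<partial>M) \<le> ennreal (exp (4 * C2\<^sup>2 * (b p)\<^sup>2))" if pU: "p \<in> ?U" for p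
  proof -
    obtain i j where p: "p = (i, j)" "i \<le> j" "j < n" using pU by (cases p) auto
    have "has_bochner_integral M (\<lambda>\<omega>. E \<omega> $$ p) 0" "psi2_norm M (\<lambda>\<omega>. E \<omega> $$ p) \<le> ennreal C2"
      using E p le_less_trans[OF p(2,3)] by (auto simp: sub_gaussian_matrix_def)
    from sub_gaussian_mgf[OF M this(1) _ psi2_norm_exp_square[OF this(2) C2], of "b p"] C2
    show ?thesis by (simp add: power_mult_distrib)
  qed
  have "(\<Sum>p\<in>?U. (b p)\<^sup>2) \<le> (\<Sum>(i, j)\<in>?U. if i = j then 2 * (a i i)\<^sup>2 else 2 * (a i j)\<^sup>2 + 2 * (a j i)\<^sup>2)"
  proof (rule sum_mono, clarify)
    fix i j
    have "0 \<le> (a i j - a j i)\<^sup>2" by simp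
    then have "(a i j + a j i)\<^sup>2 \<le> 2 * (a i j)\<^sup>2 + 2 * (a j i)\<^sup>2"
      by (simp add: power2_sum power2_diff)
    then show "(b (i, j))\<^sup>2 \<le> (if i = j then 2 * (a i i)\<^sup>2 else 2 * (a i j)\<^sup>2 + 2 * (a j i)\<^sup>2)"
      by (simp add: b_def)
  qed
  also have "\<dots> = (\<Sum>i<n. \<Sum>j<n. 2 * (a i j)\<^sup>2)"
    by (rule sum_square_upper_triangle[symmetric])
  finally have b2: "(\<Sum>p\<in>?U. (b p)\<^sup>2) \<le> 2 * (\<Sum>i<n. \<Sum>j<n. (a i j)\<^sup>2)"
    by (simp add: sum_distrib_left)
  have "(\<integral>\<^sup>+\<omega>. ennreal (exp (\<Sum>i<n. \<Sum>j<n. a i j * E \<omega> $$ (i, j))) \<partial>M)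
      = (\<integral>\<^sup>+\<omega>. (\<Prod>p\<in>?U. ennreal (exp (b p * E \<omega> $$ p))) \<partial>M)"
    by (intro nn_integral_cong) (simp add: sum exp_sum fin prod_ennreal)
  also have "\<dots> = (\<Prod>p\<in>?U. \<integral>\<^sup>+\<omega>. ennreal (exp (b p * E \<omega> $$ p)) \<partial>M)"
    by (rule indep_vars_nn_integral[OF fin indep]) simp
  also have "\<dots> \<le> (\<Prod>p\<in>?U. ennreal (exp (4 * C2\<^sup>2 * (b p)\<^sup>2)))"
    by (intro prod_mono_ennreal one)
  also have "\<dots> = ennreal (exp (4 * C2\<^sup>2 * (\<Sum>p\<in>?U. (b p)\<^sup>2)))"
    by (simp add: prod_ennreal exp_sum fin sum_distrib_left)
  also have "\<dots> \<le> ennreal (exp (8 * C2\<^sup>2 * (\<Sum>i<n. \<Sum>j<n. (a i j)\<^sup>2)))"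
    using mult_left_mono[OF b2, of "4 * C2\<^sup>2"] by (intro ennreal_leI) simp
  finally show ?thesis .
qed

section \<open>Events of high probability\<close>

lemma quad_measurable:
  assumes "sub_gaussian_matrix C1 C2 n M E"
  shows "(\<lambda>\<omega>. quad n (E \<omega>) x) \<in> borel_measurable M"
proof -
  note [measurable] = sub_gaussian_matrix_entry[OF assms]
  show ?thesis unfolding quad_def by (intro borel_measurable_sum borel_measurable_times) auto
qed

lemma rotated_measurable:
  assumes "sub_gaussian_matrix C1 C2 n M E"
  shows "(\<lambda>\<omega>. rotated n Q (E \<omega>) i j) \<in> borel_measurable M"
proof -
  note [measurable] = sub_gaussian_matrix_entry[OF assms]
  show ?thesis unfolding rotated_def by (intro borel_measurable_sum borel_measurable_times) auto
qed

text \<open>Chernoff bound with parameter \<open>1 / sqrt n\<close>, for both signs. The squared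
  coefficients sum to at most \<open>(7 * n)\<^sup>2 / n = 49 * n\<close>, and
  \<open>8 * 49 = 392\<close>.\<close>

lemma quad_tail:
  assumes M: "prob_space M" and E: "sub_gaussian_matrix C1 C2 n M E" and C2: "C2 > 0"
    and n: "n \<ge> 1" and z: "(\<Sum>i<n. (x i)\<^sup>2) \<le> 7 * real n"
  shows "measure M {\<omega> \<in> space M. \<bar>quad n (E \<omega>) x\<bar> \<ge> \<tau> * sqrt (real n) * real n}
    \<le> 2 * exp ((392 * C2\<^sup>2 - \<tau>) * real n)"
proof -
  interpret prob_space M by (rule M)
  note [measurable] = quad_measurable[OF E, of x]
  define s where "s = 1 / sqrt (real n)"
  have s: "s > 0" "s\<^sup>2 = 1 / real n" "s * sqrt (real n) = 1"
    using n by (auto simp: s_def power_divide)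
  let ?b = "\<tau> * sqrt (real n) * real n"
  have sb: "s * ?b = \<tau> * real n" using s(3) by (metis mult.assoc mult.commute mult.right_neutral)
  have tail: "emeasure M {\<omega> \<in> space M. e * quad n (E \<omega>) x \<ge> ?b} \<le> ennreal (exp ((392 * C2\<^sup>2 - \<tau>) * real n))"
    if e: "e\<^sup>2 = 1" for e :: real
  proof -
    let ?a = "\<lambda>i j. s * e * (x i * x j)"
    have "(\<Sum>i<n. \<Sum>j<n. (?a i j)\<^sup>2) = s\<^sup>2 * ((\<Sum>i<n. (x i)\<^sup>2) * (\<Sum>i<n. (x i)\<^sup>2))"
      unfolding sum_product unfolding sum_distrib_left by (simp add: power_mult_distrib e)
    also have "\<dots> \<le> s\<^sup>2 * ((7 * real n) * (7 * real n))"
      using z by (intro mult_left_mono mult_mono sum_nonneg) auto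
    also have "\<dots> = 49 * real n" using n by (simp add: s(2))
    finally have a2: "8 * C2\<^sup>2 * (\<Sum>i<n. \<Sum>j<n. (?a i j)\<^sup>2) \<le> 8 * C2\<^sup>2 * (49 * real n)"
      by (intro mult_left_mono) auto
    have "emeasure M {\<omega> \<in> space M. e * quad n (E \<omega>) x \<ge> ?b}
        \<le> ennreal (exp (- s * ?b)) * (\<integral>\<^sup>+\<omega>. ennreal (exp (s * (e * quad n (E \<omega>) x))) * indicator (space M) \<omega> \<partial>M)"
      by (rule Chernoff_ineq_nn_integral_ge) (use s in auto)
    also have "(\<integral>\<^sup>+\<omega>. ennreal (exp (s * (e * quad n (E \<omega>) x))) * indicator (space M) \<omega> \<partial>M)
        = (\<integral>\<^sup>+\<omega>. ennreal (exp (\<Sum>i<n. \<Sum>j<n. ?a i j * E \<omega> $$ (i, j))) \<partial>M)"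
      by (intro nn_integral_cong) (simp add: quad_def sum_distrib_left mult_ac)
    also have "\<dots> \<le> ennreal (exp (8 * C2\<^sup>2 * (\<Sum>i<n. \<Sum>j<n. (?a i j)\<^sup>2)))"
      by (rule sub_gaussian_matrix_mgf[OF M E C2])
    also have "\<dots> \<le> ennreal (exp (8 * C2\<^sup>2 * (49 * real n)))"
      using a2 by (intro ennreal_leI) simp
    also have "ennreal (exp (- s * ?b)) * \<dots> = ennreal (exp (- (\<tau> * real n) + 8 * C2\<^sup>2 * (49 * real n)))"
      unfolding mult_minus_left sb by (simp only: ennreal_mult[symmetric] exp_ge_zero exp_add)
    also have "- (\<tau> * real n) + 8 * C2\<^sup>2 * (49 * real n) = (392 * C2\<^sup>2 - \<tau>) * real n"
      by (simp add: algebra_simps)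
    finally show ?thesis by (simp add: mult_left_mono)
  qed
  have "{\<omega> \<in> space M. \<bar>quad n (E \<omega>) x\<bar> \<ge> ?b}
      \<subseteq> {\<omega> \<in> space M. 1 * quad n (E \<omega>) x \<ge> ?b} \<union> {\<omega> \<in> space M. (- 1) * quad n (E \<omega>) x \<ge> ?b}"
    by auto
  then have "measure M {\<omega> \<in> space M. \<bar>quad n (E \<omega>) x\<bar> \<ge> ?b}
      \<le> measure M ({\<omega> \<in> space M. 1 * quad n (E \<omega>) x \<ge> ?b} \<union> {\<omega> \<in> space M. (- 1) * quad n (E \<omega>) x \<ge> ?b})"
    by (intro finite_measure_mono) auto
  also have "\<dots> \<le> measure M {\<omega> \<in> space M. 1 * quad n (E \<omega>) x \<ge> ?b} + measure M {\<omega> \<in> space M. (- 1) * quad n (E \<omega>) x \<ge> ?b}"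
    by (rule measure_Un_le) auto
  also have "\<dots> \<le> exp ((392 * C2\<^sup>2 - \<tau>) * real n) + exp ((392 * C2\<^sup>2 - \<tau>) * real n)"
    using tail[of 1] tail[of "-1"] by (intro add_mono) (auto simp: emeasure_eq_measure)
  finally show ?thesis by simp
qed

text \<open>With this \<open>\<tau>\<close> each grid point fails with probability at most
  \<open>2 * exp (- 8 * n)\<close>. The number of points costs at most \<open>exp (7 * n)\<close>,
  as \<open>384 \<le> exp 7\<close>, so one factor \<open>exp (- n)\<close> is left.\<close>

lemma grid_event:
  assumes M: "prob_space M" and E: "sub_gaussian_matrix C1 C2 n M E" and C2: "C2 > 0"
    and n: "n \<ge> 1" and \<tau>: "\<tau> = 392 * C2\<^sup>2 + 8"
  defines "G \<equiv> {\<omega> \<in> space M. \<forall>z\<in>grid n. \<bar>quad n (E \<omega>) (\<lambda>i. real_of_int (z i))\<bar> < \<tau> * sqrt (real n) * real n}"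
  shows "G \<in> sets M" and "measure M G \<ge> 1 - 2 * exp (- real n)"
proof -
  interpret prob_space M by (rule M)
  note [measurable] = quad_measurable[OF E]
  note fin [simp] = card_grid(1)[of n]
  show G: "G \<in> sets M"
    unfolding G_def by (intro sets.sets_Collect_finite_All) auto
  define B where "B z = {\<omega> \<in> space M. \<bar>quad n (E \<omega>) (\<lambda>i. real_of_int (z i))\<bar> \<ge> \<tau> * sqrt (real n) * real n}" for z :: "nat \<Rightarrow> int"
  have "space M - G = (\<Union>z\<in>grid n. B z)"
    by (auto simp: G_def B_def not_less)
  then have "1 - measure M G = measure M (\<Union>z\<in>grid n. B z)"
    using prob_compl[OF G] by simp
  also have "\<dots> \<le> (\<Sum>z\<in>grid n. measure M (B z))"
    by (intro finite_measure_subadditive_finite) (auto simp: B_def)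
  also have "\<dots> \<le> (\<Sum>z\<in>grid n. 2 * exp (- 8 * real n))"
  proof (rule sum_mono)
    fix z assume "z \<in> grid n"
    then show "measure M (B z) \<le> 2 * exp (- 8 * real n)"
      using quad_tail[OF M E C2 n, of "\<lambda>i. real_of_int (z i)" \<tau>] unfolding B_def \<tau> by (simp add: grid_def)
  qed
  also have "\<dots> \<le> 384 ^ n * (2 * exp (- 8 * real n))"
    using mult_right_mono[OF card_grid(2)[of n], of "2 * exp (- 8 * real n)"] by simp
  also have "(384 :: real) ^ n \<le> exp 7 ^ n"
  proof (rule power_mono)
    have "(384 :: real) \<le> (5 / 2) ^ 7" by (simp add: power_divide)
    also have "\<dots> \<le> exp 1 ^ 7"
      using exp_lower_Taylor_quadratic[of 1] by (intro power_mono) auto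
    also have "\<dots> = exp (7 :: real)" by (simp flip: exp_of_nat_mult)
    finally show "(384 :: real) \<le> exp 7" .
  qed simp
  also have "exp 7 ^ n * (2 * exp (- 8 * real n)) = 2 * exp (- real n)"
    by (simp flip: exp_of_nat_mult exp_add)
  finally show "measure M G \<ge> 1 - 2 * exp (- real n)" by simp
qed

text \<open>A rotated entry is a linear form in \<open>E\<close> whose coefficients are the products
  of the coordinates of two unit vectors. Its moment generating function at 1 and -1 is thus bounded
  independently of \<open>n\<close>, and these two values dominate the second moment.\<close>

lemma rotated_second_moment:
  assumes M: "prob_space M" and E: "sub_gaussian_matrix C1 C2 n M E" and C2: "C2 > 0"
    and Q: "\<And>j. j < n \<Longrightarrow> L2_set (\<lambda>k. Q $$ (k, j)) {..<n} = 1" and ij: "i < n" "j < n"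
  shows "(\<integral>\<^sup>+\<omega>. ennreal ((rotated n Q (E \<omega>) i j)\<^sup>2) \<partial>M) \<le> ennreal (4 * exp (8 * C2\<^sup>2))"
proof -
  note [measurable] = rotated_measurable[OF E, of Q i j]
  have mgf: "(\<integral>\<^sup>+\<omega>. ennreal (exp (e * rotated n Q (E \<omega>) i j)) \<partial>M) \<le> ennreal (exp (8 * C2\<^sup>2))"
    if e: "e\<^sup>2 = 1" for e :: real
  proof -
    let ?a = "\<lambda>k l. e * (Q $$ (k, i) * Q $$ (l, j))"
    have col: "(\<Sum>k<n. (Q $$ (k, m))\<^sup>2) = 1" if "m < n" for m
      using Q[OF that] by (simp add: L2_set_def)
    have "(\<Sum>k<n. \<Sum>l<n. (?a k l)\<^sup>2) = (\<Sum>k<n. (Q $$ (k, i))\<^sup>2) * (\<Sum>l<n. (Q $$ (l, j))\<^sup>2)"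
      unfolding sum_product by (simp add: power_mult_distrib e)
    then have "(\<Sum>k<n. \<Sum>l<n. (?a k l)\<^sup>2) = 1" by (simp add: col ij)
    moreover have "e * rotated n Q (E \<omega>) i j = (\<Sum>k<n. \<Sum>l<n. ?a k l * E \<omega> $$ (k, l))" for \<omega>
      by (simp add: rotated_def sum_distrib_left mult_ac)
    ultimately show ?thesis
      using sub_gaussian_matrix_mgf[OF M E C2, of ?a] by simp
  qed
  have sq: "x\<^sup>2 \<le> 2 * exp (1 * x) + 2 * exp ((- 1) * x)" for x :: real
  proof -
    have "1 + \<bar>x\<bar> + \<bar>x\<bar>\<^sup>2 / 2 \<le> exp \<bar>x\<bar>" by (rule exp_lower_Taylor_quadratic) simp
    then have "x\<^sup>2 \<le> 2 * exp \<bar>x\<bar>" by simp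
    also have "\<dots> \<le> 2 * exp (1 * x) + 2 * exp ((- 1) * x)" by (cases "x \<ge> 0") auto
    finally show ?thesis .
  qed
  have "(\<integral>\<^sup>+\<omega>. ennreal ((rotated n Q (E \<omega>) i j)\<^sup>2) \<partial>M)
      \<le> (\<integral>\<^sup>+\<omega>. 2 * ennreal (exp (1 * rotated n Q (E \<omega>) i j)) + 2 * ennreal (exp ((- 1) * rotated n Q (E \<omega>) i j)) \<partial>M)"
  proof (intro nn_integral_mono)
    fix \<omega>
    let ?x = "rotated n Q (E \<omega>) i j"
    have "ennreal (?x\<^sup>2) \<le> ennreal (2 * exp (1 * ?x) + 2 * exp ((- 1) * ?x))"
      by (rule ennreal_leI[OF sq])
    then show "ennreal (?x\<^sup>2) \<le> 2 * ennreal (exp (1 * ?x)) + 2 * ennreal (exp ((- 1) * ?x))"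
      by (simp add: ennreal_plus ennreal_mult)
  qed
  also have "\<dots> = 2 * (\<integral>\<^sup>+\<omega>. ennreal (exp (1 * rotated n Q (E \<omega>) i j)) \<partial>M)
      + 2 * (\<integral>\<^sup>+\<omega>. ennreal (exp ((- 1) * rotated n Q (E \<omega>) i j)) \<partial>M)"
    by (subst nn_integral_add) (auto simp: nn_integral_cmult)
  also have "\<dots> \<le> 2 * ennreal (exp (8 * C2\<^sup>2)) + 2 * ennreal (exp (8 * C2\<^sup>2))"
    by (intro add_mono mult_left_mono mgf) auto
  also have "\<dots> = ennreal (4 * exp (8 * C2\<^sup>2))"
    by (simp add: ennreal_mult flip: distrib_right)
  finally show ?thesis .
qed

text \<open>Markov's inequality for a sum of \<open>(card S)\<^sup>2\<close> terms of bounded mean;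
  dependence among the rotated entries does no harm.\<close>

lemma frobenius_event:
  assumes M: "prob_space M" and E: "sub_gaussian_matrix C1 C2 n M E" and C2: "C2 > 0"
    and Q: "\<And>j. j < n \<Longrightarrow> L2_set (\<lambda>k. Q $$ (k, j)) {..<n} = 1"
    and S: "S \<subseteq> {..<n}" and \<Phi>: "\<Phi> > 0"
  defines "H \<equiv> {\<omega> \<in> space M. (\<Sum>i\<in>S. \<Sum>j\<in>S. (rotated n Q (E \<omega>) i j)\<^sup>2) < \<Phi>\<^sup>2}"
  shows "H \<in> sets M"
    and "measure M H \<ge> 1 - 4 * exp (8 * C2\<^sup>2) * (real (card S))\<^sup>2 / \<Phi>\<^sup>2"
proof -
  interpret prob_space M by (rule M)
  note [measurable] = rotated_measurable[OF E, of Q]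
  define f where "f \<omega> = (\<Sum>i\<in>S. \<Sum>j\<in>S. (rotated n Q (E \<omega>) i j)\<^sup>2)" for \<omega>
  have f[measurable]: "f \<in> borel_measurable M" unfolding f_def by measurable
  show H: "H \<in> sets M" unfolding H_def f_def[symmetric] by measurable
  let ?c = "4 * exp (8 * C2\<^sup>2)"
  have "(\<integral>\<^sup>+\<omega>. ennreal (f \<omega>) \<partial>M) = (\<integral>\<^sup>+\<omega>. (\<Sum>i\<in>S. \<Sum>j\<in>S. ennreal ((rotated n Q (E \<omega>) i j)\<^sup>2)) \<partial>M)"
    unfolding f_def by (intro nn_integral_cong) (simp add: sum_ennreal sum_nonneg)
  also have "\<dots> = (\<Sum>i\<in>S. \<Sum>j\<in>S. \<integral>\<^sup>+\<omega>. ennreal ((rotated n Q (E \<omega>) i j)\<^sup>2) \<partial>M)"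
  proof -
    have "(\<integral>\<^sup>+\<omega>. (\<Sum>i\<in>S. \<Sum>j\<in>S. ennreal ((rotated n Q (E \<omega>) i j)\<^sup>2)) \<partial>M)
        = (\<Sum>i\<in>S. \<integral>\<^sup>+\<omega>. (\<Sum>j\<in>S. ennreal ((rotated n Q (E \<omega>) i j)\<^sup>2)) \<partial>M)"
      by (rule nn_integral_sum) measurable
    also have "\<dots> = (\<Sum>i\<in>S. \<Sum>j\<in>S. \<integral>\<^sup>+\<omega>. ennreal ((rotated n Q (E \<omega>) i j)\<^sup>2) \<partial>M)"
      by (intro sum.cong refl nn_integral_sum) measurable
    finally show ?thesis .
  qed
  also have "\<dots> \<le> (\<Sum>i\<in>S. \<Sum>j\<in>S. ennreal ?c)"
    using S by (intro sum_mono rotated_second_moment[OF M E C2 Q]) auto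
  also have "\<dots> = ennreal (?c * (real (card S))\<^sup>2)"
    by (simp add: sum_ennreal sum_nonneg power2_eq_square mult_ac del: sum_constant) (simp add: mult_ac)
  finally have int: "(\<integral>\<^sup>+\<omega>. ennreal (f \<omega>) \<partial>M) \<le> ennreal (?c * (real (card S))\<^sup>2)" .
  have "space M - H = {\<omega> \<in> space M. 1 \<le> ennreal (1 / \<Phi>\<^sup>2) * ennreal (f \<omega>)}"
  proof -
    have "f \<omega> \<ge> 0" for \<omega> by (auto simp: f_def intro!: sum_nonneg)
    moreover have "(1 \<le> ennreal (f \<omega> / \<Phi>\<^sup>2)) \<longleftrightarrow> \<Phi>\<^sup>2 \<le> f \<omega>" for \<omega>
      using \<Phi> by (simp add: ennreal_ge_1 le_divide_eq)
    ultimately show ?thesis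
      by (auto simp: H_def f_def[symmetric] simp flip: ennreal_mult)
  qed
  then have "emeasure M (space M - H) \<le> ennreal (1 / \<Phi>\<^sup>2) * (\<integral>\<^sup>+\<omega>. ennreal (f \<omega>) * indicator (space M) \<omega> \<partial>M)"
    using nn_integral_Markov_inequality[of "\<lambda>\<omega>. ennreal (f \<omega>)" "space M" M "ennreal (1 / \<Phi>\<^sup>2)"] by simp
  also have "(\<integral>\<^sup>+\<omega>. ennreal (f \<omega>) * indicator (space M) \<omega> \<partial>M) = (\<integral>\<^sup>+\<omega>. ennreal (f \<omega>) \<partial>M)"
    by (intro nn_integral_cong) simp
  also have "ennreal (1 / \<Phi>\<^sup>2) * \<dots> \<le> ennreal (1 / \<Phi>\<^sup>2) * ennreal (?c * (real (card S))\<^sup>2)"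
    by (intro mult_left_mono int) simp
  also have "\<dots> = ennreal (?c * (real (card S))\<^sup>2 / \<Phi>\<^sup>2)"
    by (simp flip: ennreal_mult)
  finally have "measure M (space M - H) \<le> ?c * (real (card S))\<^sup>2 / \<Phi>\<^sup>2"
    unfolding emeasure_eq_measure by (subst (asm) ennreal_le_iff) auto
  then show "measure M H \<ge> 1 - ?c * (real (card S))\<^sup>2 / \<Phi>\<^sup>2"
    using prob_compl[OF H] by simp
qed

text \<open>A non-measurable set would have \<open>measure\<close> 0, so lower bounds through
  subevents depend on this. The set is a countable intersection, over integer vectors, of
  inequalities between measurable functions.\<close>

lemma least_singular_value_event:
  assumes E: "sub_gaussian_matrix C1 C2 n M E" and n: "n \<ge> 1"
    and A: "A \<in> carrier_mat n n" "transpose_mat A = A"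
  shows "{\<omega> \<in> space M. s \<le> singular_value (A + E \<omega>) n} \<in> sets M"
proof -
  note [measurable] = sub_gaussian_matrix_entry[OF E]
  have carr: "E \<omega> \<in> carrier_mat n n" "transpose_mat (E \<omega>) = E \<omega>" if "\<omega> \<in> space M" for \<omega>
    using E that by (auto simp: sub_gaussian_matrix_def)
  define f where "f x \<omega> = L2_set (\<lambda>i. \<Sum>j<n. (A $$ (i, j) + E \<omega> $$ (i, j)) * x j) {..<n}" for x \<omega>
  have f: "L2_set (mat_app n (A + E \<omega>) x) {..<n} = f x \<omega>" if "\<omega> \<in> space M" for x \<omega>
    unfolding f_def mat_app_def using carr(1)[OF that] A(1)
    by (intro L2_set_cong sum.cong) auto
  have [measurable]: "f x \<in> borel_measurable M" for x
    unfolding f_def L2_set_def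
    by (intro measurable_compose[OF _ borel_measurable_sqrt] borel_measurable_sum borel_measurable_power
        borel_measurable_times borel_measurable_add) auto
  have "{\<omega> \<in> space M. s \<le> singular_value (A + E \<omega>) n} = {\<omega> \<in> space M. \<forall>zs :: int list.
      s * L2_set (\<lambda>i. real_of_int (zs ! i)) {..<n} \<le> f (\<lambda>i. real_of_int (zs ! i)) \<omega>}"
    using le_least_singular_value_iff_int[OF transpose_add_symmetric[OF A carr] n]
    by (auto simp: f)
  also have "\<dots> \<in> sets M" by measurable
  finally show ?thesis .
qed

text \<open>
  Since \<open>L \<le> \<sigma>\<^sub>1\<close>, the factor \<open>ln (3 + \<sigma>\<^sub>1)\<close> in \<open>L\<close> is at least \<open>ln n / 4\<close>, which absorbs every
  constant depending on \<open>C2\<close> for large \<open>n\<close>.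
\<close>

lemma log_factor_bounds:
  fixes \<sigma> \<sigma>1 K L :: real and n r :: nat
  assumes n: "n \<ge> 3" and K: "K > 0" and r: "r \<ge> 1" and \<sigma>: "L \<le> \<sigma>" "\<sigma> \<le> \<sigma>1" "0 \<le> \<sigma>"
    and L: "L = 270 * ln (3 + \<sigma>1) * max (sqrt (real n) / K) (sqrt (real r * ln (real n)) * real n powr (1 / 4))"
  shows "L \<ge> 0"
    and "L / 2 \<ge> 4 * ln (real n) * sqrt (real n) / K"
    and "L / 2 \<ge> 4 * ln (real n) * sqrt (real r) * real n powr (1 / 4)"
proof -
  have e3: "exp 1 \<le> (3 :: real)" by (rule exp_le)
  have ln1: "1 \<le> ln y" if "3 \<le> y" for y :: real
    using that e3 by (subst ln_ge_iff) auto
  have g: "1 \<le> ln (real n)" using n by (intro ln1) simp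
  let ?m = "max (sqrt (real n) / K) (sqrt (real r * ln (real n)) * real n powr (1 / 4))"
  have rg: "1 \<le> real r * ln (real n)" using r g mult_mono[of 1 "real r" 1 "ln (real n)"] by simp
  have m_ge: "real n powr (1 / 4) \<le> ?m"
  proof -
    have "1 * real n powr (1 / 4) \<le> sqrt (real r * ln (real n)) * real n powr (1 / 4)"
      using rg by (intro mult_right_mono) auto
    then show ?thesis by simp
  qed
  have m0: "0 \<le> ?m" using m_ge by (rule order.trans[rotated]) simp
  have l3: "1 \<le> ln (3 + \<sigma>1)" using \<sigma> by (intro ln1) simp
  \<comment> \<open>The second entry of the maximum alone makes \<open>L\<close>, and with it
    \<open>\<sigma>1\<close>, at least \<open>n powr (1 / 4)\<close>.\<close>
  have "1 * real n powr (1 / 4) \<le> 270 * ln (3 + \<sigma>1) * ?m"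
    using l3 m_ge by (intro mult_mono) auto
  then have "real n powr (1 / 4) \<le> 3 + \<sigma>1" using \<sigma> L by simp
  then have "ln (real n powr (1 / 4)) \<le> ln (3 + \<sigma>1)" using n by (intro ln_mono) auto
  then have lg: "ln (real n) / 4 \<le> ln (3 + \<sigma>1)" using n by (simp add: ln_powr)
  show "L \<ge> 0" unfolding L using l3 m0 by simp
  have main: "L / 2 \<ge> 4 * ln (real n) * m" if "0 \<le> m" "m \<le> ?m" for m
  proof -
    \<comment> \<open>By \<open>lg\<close>, \<open>8 * ln n\<close> is at most
      \<open>32 * ln (3 + \<sigma>1)\<close>, well within the factor 270.\<close>
    have "8 * ln (real n) * m \<le> 270 * ln (3 + \<sigma>1) * ?m"
      using lg l3 that by (intro mult_mono[of "8 * ln (real n)" "270 * ln (3 + \<sigma>1)"]) auto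
    then show ?thesis using L by (simp add: mult_ac)
  qed
  show "L / 2 \<ge> 4 * ln (real n) * sqrt (real n) / K"
    using main[of "sqrt (real n) / K"] K by simp
  have "sqrt (real r) * real n powr (1 / 4) \<le> sqrt (real r * ln (real n)) * real n powr (1 / 4)"
    using g r by (intro mult_right_mono) auto
  then have "sqrt (real r) * real n powr (1 / 4) \<le> ?m" by simp
  from main[OF _ this] show "L / 2 \<ge> 4 * ln (real n) * sqrt (real r) * real n powr (1 / 4)"
    by (simp add: mult.assoc)
qed

section \<open>Choice of parameters and conclusion\<close>

lemma least_singular_value_high_probability:
  fixes A :: "real mat"
  assumes C2: "C2 > 0" and n: "n \<ge> 3"
    and \<tau>: "\<tau> = 392 * C2\<^sup>2 + 8" and large: "\<tau>\<^sup>2 \<le> ln (real n)"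
    and A: "A \<in> carrier_mat n n" "transpose_mat A = A"
    and M: "prob_space M" and E: "sub_gaussian_matrix C1 C2 n M E" and K: "K > 0"
    and r: "r = card {k \<in> {1..n}. singular_value A k < singular_value A n + 3 * K * sqrt (real n)}"
    and L: "L = 270 * ln (3 + singular_value A 1) *
             max (sqrt (real n) / K) (sqrt (real r * ln (real n)) * real n powr (1 / 4))"
    and \<sigma>: "singular_value A n \<ge> L"
  shows "measure M {\<omega> \<in> space M. singular_value A n - L / 2 \<le> singular_value (A + E \<omega>) n}
    \<ge> 1 - (2 * exp (- real n) + 4 * exp (8 * C2\<^sup>2) / (ln (real n))\<^sup>2)"
proof -
  interpret prob_space M by (rule M)
  have n1: "n \<ge> 1" using n by simp
  obtain Q d where Q: "Q \<in> carrier_mat n n" "transpose_mat Q * Q = 1\<^sub>m n" "Q * transpose_mat Q = 1\<^sub>m n"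
    and Ad: "A = Q * diag n d * transpose_mat Q"
    using symmetric_spectral_decomposition[OF A] by blast
  define T where "T = 3 * K * sqrt (real n)"
  have T: "T > 0" using K n by (simp add: T_def)
  define S where "S = {i. i < n \<and> \<bar>d i\<bar> < singular_value A n + T}"
  have rS: "r = card S"
    unfolding r S_def T_def by (rule card_small_singular_values[OF Q Ad A(2)])
  obtain i0 where i0: "i0 < n" "singular_value A n = \<bar>d i0\<bar>"
    using least_singular_value(2)[OF Q Ad A(2) n1] by blast
  have finS: "finite S" "S \<subseteq> {..<n}" by (auto simp: S_def)
  \<comment> \<open>The coordinate attaining the minimum lies in \<open>S\<close>, so
    \<open>r\<close> is at least 1 and the second entry of the maximum in \<open>L\<close> does not
    vanish.\<close>
  have "i0 \<in> S" using i0 T by (simp add: S_def)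
  then have r1: "r \<ge> 1" unfolding rS using card_gt_0_iff[of S] finS(1) by fastforce
  let ?g = "ln (real n)" and ?q = "real n powr (1 / 4)"
  have sv1: "singular_value A n \<le> singular_value A 1"
    by (rule singular_value_antimono[OF A]) (use n in auto)
  have sv0: "0 \<le> singular_value A n" using i0 by simp
  note Lb = log_factor_bounds[OF n K r1 \<sigma> sv1 sv0 L]
  have \<tau>1: "\<tau> \<ge> 1" unfolding \<tau> using zero_le_power2[of C2] by linarith
  then have g1: "\<tau> \<le> ?g" "1 \<le> ?g"
    using large by (smt (verit) self_le_power zero_less_numeral one_le_power)+
  have qq: "?q * ?q = sqrt (real n)" "sqrt (real n) * sqrt (real n) = real n"
    using n by (simp_all add: powr_half_sqrt flip: powr_add)
  define N where "N = \<tau> * sqrt (real n)"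
  define G where "G = {\<omega> \<in> space M. \<forall>z\<in>grid n. \<bar>quad n (E \<omega>) (\<lambda>i. real_of_int (z i))\<bar> < \<tau> * sqrt (real n) * real n}"
  have G: "G \<in> sets M" "measure M G \<ge> 1 - 2 * exp (- real n)"
    unfolding G_def by (rule grid_event[OF M E C2 n1 \<tau>])+
  have carr: "E \<omega> \<in> carrier_mat n n" "transpose_mat (E \<omega>) = E \<omega>" if "\<omega> \<in> space M" for \<omega>
    using E that by (auto simp: sub_gaussian_matrix_def)
  have norm: "L2_set (mat_app n (E \<omega>) z) {..<n} \<le> N * L2_set z {..<n}" if "\<omega> \<in> G" for \<omega> z
    using that carr[of \<omega>] n1 unfolding N_def G_def
    by (intro operator_norm_le_grid) (auto intro: less_imp_le)
  define V where "V = {\<omega> \<in> space M. singular_value A n - L / 2 \<le> singular_value (A + E \<omega>) n}"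
  have V: "V \<in> sets M" unfolding V_def by (rule least_singular_value_event[OF E n1 A])
  have c0: "4 * exp (8 * C2\<^sup>2) / ?g\<^sup>2 \<ge> 0" by simp
  show ?thesis
  proof (cases "N \<le> L / 2")
    case True
    have "G \<subseteq> V"
    proof
      fix \<omega> assume w: "\<omega> \<in> G"
      then have "\<omega> \<in> space M" by (simp add: G_def)
      then show "\<omega> \<in> V"
        using least_singular_value_weyl[OF n1 A carr norm[OF w]] True by (simp add: V_def)
    qed
    then have "measure M G \<le> measure M V" by (rule finite_measure_mono[OF _ V])
    then show ?thesis unfolding V_def[symmetric] using G(2) c0 by linarith
  next
    case False
    \<comment> \<open>For \<open>K \<le> \<tau>\<close> the first entry of the maximum would already
      give \<open>L / 2 \<ge> N\<close>, because
      \<open>\<tau> * K \<le> \<tau>\<^sup>2 \<le> ln n\<close>.\<close>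
    have K\<tau>: "\<tau> < K"
    proof (rule ccontr)
      assume "\<not> \<tau> < K"
      then have "\<tau> * K \<le> \<tau> * \<tau>" using \<tau>1 by (intro mult_left_mono) auto
      also have "\<dots> \<le> 4 * ?g" using large g1 by (simp add: power2_eq_square)
      finally have "\<tau> * K * sqrt (real n) \<le> 4 * ?g * sqrt (real n)" by (intro mult_right_mono) auto
      then have "N \<le> 4 * ?g * sqrt (real n) / K" using K by (simp add: N_def field_simps)
      then show False using Lb(2) False by linarith
    qed
    \<comment> \<open>For \<open>r > sqrt n\<close> the second entry would give
      \<open>L / 2 \<ge> N\<close>, as \<open>sqrt r * n powr (1 / 4)\<close> is then at least
      \<open>sqrt n\<close> and \<open>\<tau> \<le> ln n\<close>.\<close>
    have r_le: "real r \<le> sqrt (real n)"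
    proof (rule ccontr)
      assume "\<not> real r \<le> sqrt (real n)"
      then have "?q\<^sup>2 \<le> (sqrt (real r))\<^sup>2" unfolding power2_eq_square[of ?q] qq(1) by simp
      then have "?q \<le> sqrt (real r)" by (rule power2_le_imp_le) simp
      then have "?q * ?q \<le> sqrt (real r) * ?q" by (intro mult_right_mono) auto
      then have "sqrt (real n) \<le> sqrt (real r) * ?q" unfolding qq(1) .
      then have "\<tau> * sqrt (real n) \<le> 4 * ?g * (sqrt (real r) * ?q)"
        using g1 by (intro mult_mono) auto
      then show False using Lb(3) False by (simp add: N_def mult.assoc)
    qed
    \<comment> \<open>The budget \<open>L / 2\<close> is split evenly between the small block and
      the second order term.\<close>
    define \<Phi> where "\<Phi> = L / 4"
    have half: "?g * (sqrt (real r) * ?q) \<le> \<Phi>" using Lb(3) Lb(1) by (simp add: \<Phi>_def mult.assoc)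
    have "0 < ?g * (sqrt (real r) * ?q)" using g1 r1 n by (intro mult_pos_pos) auto
    then have \<Phi>: "\<Phi> > 0" using half by linarith
    have N2: "\<Phi> + 2 * N\<^sup>2 / T \<le> L / 2"
    proof -
      have "2 * N\<^sup>2 / T = 2 / 3 * (\<tau>\<^sup>2 * sqrt (real n) / K)"
      proof -
        define m where "m = sqrt (real n)"
        have "m > 0" using n by (simp add: m_def)
        then show ?thesis
          unfolding N_def T_def m_def[symmetric] using K by (simp add: power2_eq_square)
      qed
      also have "\<dots> \<le> 2 / 3 * (?g * sqrt (real n) / K)"
        using large K by (intro mult_left_mono divide_right_mono mult_right_mono) auto
      also have "\<dots> \<le> L / 4"
      proof -
        have "4 * (?g * sqrt (real n) / K) \<le> L / 2" using Lb(2) by (simp add: mult.assoc)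
        then show ?thesis using Lb(1) by linarith
      qed
      finally show ?thesis by (simp add: \<Phi>_def)
    qed
    have NT: "2 * N \<le> T"
    proof -
      have "2 * \<tau> * sqrt (real n) \<le> 3 * K * sqrt (real n)"
        using K\<tau> \<tau>1 by (intro mult_right_mono) auto
      then show ?thesis by (simp add: N_def T_def)
    qed
    define H where "H = {\<omega> \<in> space M. (\<Sum>i\<in>S. \<Sum>j\<in>S. (rotated n Q (E \<omega>) i j)\<^sup>2) < \<Phi>\<^sup>2}"
    have H: "H \<in> sets M" "measure M H \<ge> 1 - 4 * exp (8 * C2\<^sup>2) * (real (card S))\<^sup>2 / \<Phi>\<^sup>2"
      unfolding H_def
      by (rule frobenius_event[OF M E C2 symmetric_mat_app(4)[OF Q Ad] finS(2) \<Phi>]; assumption)+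
    have "?g\<^sup>2 * (real r)\<^sup>2 \<le> \<Phi>\<^sup>2"
    proof -
      \<comment> \<open>By \<open>r \<le> sqrt n\<close>, \<open>r\<^sup>2\<close> is at most
        \<open>r * sqrt n\<close>, the square of \<open>sqrt r * n powr (1 / 4)\<close>. The surplus
        factor \<open>ln n\<close> in the bound on \<open>\<Phi>\<close> makes the failure
        probability of order \<open>1 / (ln n)\<^sup>2\<close>.\<close>
      have "?g\<^sup>2 * (real r)\<^sup>2 \<le> ?g\<^sup>2 * (real r * sqrt (real n))"
        unfolding power2_eq_square[of "real r"] using r_le by (intro mult_left_mono) auto
      also have "\<dots> = (?g * (sqrt (real r) * ?q))\<^sup>2"
        unfolding qq(1)[symmetric] by (simp add: power_mult_distrib) (simp add: power2_eq_square)
      also have "\<dots> \<le> \<Phi>\<^sup>2" using half g1 by (intro power_mono) auto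
      finally show ?thesis .
    qed
    then have "(real r)\<^sup>2 / \<Phi>\<^sup>2 \<le> 1 / ?g\<^sup>2" using \<Phi> g1 by (simp add: field_simps)
    then have "4 * exp (8 * C2\<^sup>2) * ((real r)\<^sup>2 / \<Phi>\<^sup>2) \<le> 4 * exp (8 * C2\<^sup>2) * (1 / ?g\<^sup>2)"
      by (intro mult_left_mono) auto
    then have H2: "measure M H \<ge> 1 - 4 * exp (8 * C2\<^sup>2) / ?g\<^sup>2" using H(2) by (simp add: rS)
    have "G \<inter> H \<subseteq> V"
    proof
      fix \<omega> assume w: "\<omega> \<in> G \<inter> H"
      then have "\<omega> \<in> space M" by (simp add: G_def)
      moreover have "singular_value A n - L / 2 \<le> singular_value (A + E \<omega>) n"
        using w \<Phi> carr[OF \<open>\<omega> \<in> space M\<close>]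
        by (intro least_singular_value_perturb[OF n1 Q Ad A _ _ norm T NT S_def _ _ N2]) (auto simp: H_def)
      ultimately show "\<omega> \<in> V" by (simp add: V_def)
    qed
    then have "measure M (G \<inter> H) \<le> measure M V" by (rule finite_measure_mono[OF _ V])
    moreover have "measure M G + measure M H - 1 \<le> measure M (G \<inter> H)"
    proof -
      have "measure M (G \<union> H) = measure M G + measure M H - measure M (G \<inter> H)"
        by (rule measure_Un3) (use G H in \<open>auto simp: fmeasurable_eq_sets\<close>)
      then show ?thesis using prob_le_1[of "G \<union> H"] by linarith
    qed
    ultimately show ?thesis unfolding V_def[symmetric] using G(2) H2 by linarith
  qed
qed

theorem theorem2p5:
  fixes C1 C2 :: real
  assumes "C1 > 0" and "C2 > 0"
  shows "\<exists>\<delta> :: nat \<Rightarrow> real. \<delta> \<in> o(\<lambda>_. 1) \<and>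
    (\<forall>(n :: nat) (A :: real mat) (M :: 'a measure) (E :: 'a \<Rightarrow> real mat) (K :: real) (r :: nat) (L :: real).
       n \<ge> 1 \<longrightarrow>
       A \<in> carrier_mat n n \<longrightarrow> transpose_mat A = A \<longrightarrow>
       prob_space M \<longrightarrow> sub_gaussian_matrix C1 C2 n M E \<longrightarrow>
       K > 0 \<longrightarrow>
       r = card {k \<in> {1..n}. singular_value A k < singular_value A n + 3 * K * sqrt (real n)} \<longrightarrow>
       L = 270 * ln (3 + singular_value A 1) *
             max (sqrt (real n) / K) (sqrt (real r * ln (real n)) * real n powr (1 / 4)) \<longrightarrow>
       singular_value A n \<ge> L \<longrightarrow>
       measure M {\<omega> \<in> space M.
           singular_value (A + E \<omega>) n \<ge> singular_value A n - L / 2 \<and>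
           singular_value A n - L / 2 \<ge> singular_value A n / 2}
         \<ge> 1 - \<delta> n)"
proof -
  define \<tau> where "\<tau> = 392 * C2\<^sup>2 + 8"
  define p where "p n = 2 * exp (- real n) + 4 * exp (8 * C2\<^sup>2) / (ln (real n))\<^sup>2" for n
  \<comment> \<open>The value 1 makes the claim trivial for small \<open>n\<close>. Otherwise the
    bound involves only \<open>n\<close> and \<open>C2\<close>, hence is uniform in the matrices,
    the probability space and \<open>K\<close>.\<close>
  define \<delta> where "\<delta> n = (if n \<ge> 3 \<and> \<tau>\<^sup>2 \<le> ln (real n) then p n else 1)" for n
  have "p \<longlonglongrightarrow> 0" unfolding p_def by real_asymp
  moreover have "\<forall>\<^sub>F n in sequentially. \<delta> n = p n"
  proof -
    have "filterlim (\<lambda>n. ln (real n)) at_top sequentially" by real_asymp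
    then have "\<forall>\<^sub>F n in sequentially. \<tau>\<^sup>2 \<le> ln (real n)" by (simp add: filterlim_at_top)
    then show ?thesis using eventually_ge_at_top[of 3] by eventually_elim (simp add: \<delta>_def)
  qed
  ultimately have "\<delta> \<longlonglongrightarrow> 0" by (simp cong: filterlim_cong)
  then have "\<delta> \<in> o(\<lambda>_. 1)" by (intro smalloI_tendsto) auto
  moreover have "1 - \<delta> n \<le> measure M {\<omega> \<in> space M.
      singular_value (A + E \<omega>) n \<ge> singular_value A n - L / 2 \<and>
      singular_value A n - L / 2 \<ge> singular_value A n / 2}"
    if A: "A \<in> carrier_mat n n" "transpose_mat A = A" and M: "prob_space M"
      and E: "sub_gaussian_matrix C1 C2 n M E" and K: "K > 0"
      and r: "r = card {k \<in> {1..n}. singular_value A k < singular_value A n + 3 * K * sqrt (real n)}"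
      and L: "L = 270 * ln (3 + singular_value A 1) *
             max (sqrt (real n) / K) (sqrt (real r * ln (real n)) * real n powr (1 / 4))"
      and \<sigma>: "singular_value A n \<ge> L"
    for n A and M :: "'a measure" and E K r L
  proof (cases "n \<ge> 3 \<and> \<tau>\<^sup>2 \<le> ln (real n)")
    case True
    then show ?thesis
      \<comment> \<open>The second inequality in the event is equivalent to
        \<open>L \<le> singular_value A n\<close> and holds for every outcome, so the event is the
        one already treated.\<close>
      using least_singular_value_high_probability[OF assms(2) _ \<tau>_def _ A M E K r L \<sigma>] \<sigma>
      by (simp add: \<delta>_def p_def)
  qed (auto simp: \<delta>_def)
  ultimately show ?thesis by blast
qed

end
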